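(* Let $\phi\in H^{\infty}$ with $\|\phi\|_{\infty}\leq 1$. Let $Y$ be a nontrivial closed $T_{\phi}$-invariant subspace of $H^{2}$ such that, for every $f\in H^2$, $f\in Y$ if and only if $f\circ\phi\in Y$. Then there is an inner function $\theta\in H^{\infty}$ such that $Y=\theta H^{2}=\{\theta g: g\in H^2\}$.
   Context: $\mathbf{D}$ is the open unit disc in $\mathbb{C}$. $H^2$ is the Hardy space of analytic functions $f(z)=\sum_{n\ge 0}a_nz^n$ on $\mathbf{D}$ with $\sum_{n\ge 0}|a_n|^2<\infty$, a Hilbert space with inner product $(f,g)=\sum_n a_n\overline{b_n}$ for $f(z)=\sum a_nz^n$, $g(z)=\sum b_nz^n$. $H^\infty$ is the Banach space of bounded analytic functions on $\mathbf{D}$ with norm $\|\phi\|_\infty=\sup_{z\in\mathbf{D}}|\phi(z)|$. For $\phi\in H^\infty$, $T_\phi$ is the bounded operator on $H^2$ given by $(T_\phi f)(z)=\phi(z)f(z)$. A function $\theta\in H^\infty$ is inner if its nontangential boundary values satisfy $|\theta(e^{it})|=1$ almost everywhere on $\partial\mathbf{D}$. A subspace $Y$ is $T_\phi$-invariant if $T_\phi Y\subset Y$; nontrivial means $Y\neq\{0\}$. $f\circ\phi$ denotes the function $z\mapsto f(\phi(z))$ on $\mathbf{D}$; the hypothesis on $Y$ presupposes that this composition is defined, i.e. $\phi(\mathbf{D})\subset\mathbf{D}$ (automatic from $\|\phi\|_\infty\le 1$ unless $\phi$ is a constant of modulus one). *)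

theory Defs
  imports "HOL-Complex_Analysis.Complex_Analysis"
begin

abbreviation unit_disc :: "complex set" where
  "unit_disc \<equiv> ball 0 1"

definition taylor_coeff :: "(complex \<Rightarrow> complex) \<Rightarrow> nat \<Rightarrow> complex" where
  "taylor_coeff f n = fps_nth (fps_expansion f 0) n"

text \<open>A function on the disc is represented by its extension by zero to the whole plane, so
  that two elements of \<open>H2\<close> are equal iff they agree on the disc. A function holomorphic on the
  disc is there the sum of its Taylor series at 0, so \<open>taylor_coeff\<close> gives the coefficients of
  the expansion in the definition of the Hardy space.\<close>

definition H2 :: "(complex \<Rightarrow> complex) set" where
  "H2 = {f. f holomorphic_on unit_disc \<and> (\<forall>z. z \<notin> unit_disc \<longrightarrow> f z = 0) \<and>
            summable (\<lambda>n. (cmod (taylor_coeff f n))\<^sup>2)}"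

definition H2_norm :: "(complex \<Rightarrow> complex) \<Rightarrow> real" where
  "H2_norm f = sqrt (\<Sum>n. (cmod (taylor_coeff f n))\<^sup>2)"

text \<open>The default value outside \<open>H2\<close> is irrelevant; it is there because the axioms of
  \<open>Metric_space\<close> ask for symmetry and nonnegativity on the whole type.\<close>

definition H2_dist :: "(complex \<Rightarrow> complex) \<Rightarrow> (complex \<Rightarrow> complex) \<Rightarrow> real" where
  "H2_dist f g = (if f \<in> H2 \<and> g \<in> H2 then H2_norm (\<lambda>z. f z - g z) else 0)"

definition closed_subspace_H2 :: "(complex \<Rightarrow> complex) set \<Rightarrow> bool" where
  "closed_subspace_H2 Y \<longleftrightarrow>
     (\<lambda>z. 0) \<in> Y \<and>
     (\<forall>f\<in>Y. \<forall>g\<in>Y. (\<lambda>z. f z + g z) \<in> Y) \<and>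
     (\<forall>c. \<forall>f\<in>Y. (\<lambda>z. c * f z) \<in> Y) \<and>
     closedin (Metric_space.mtopology H2 H2_dist) Y"

text \<open>Only the values on the disc of elements of \<open>Hinf\<close> matter; they are not normalized
  outside it.\<close>

definition Hinf :: "(complex \<Rightarrow> complex) set" where
  "Hinf = {\<phi>. \<phi> holomorphic_on unit_disc \<and> bounded (\<phi> ` unit_disc)}"

definition Hinf_norm :: "(complex \<Rightarrow> complex) \<Rightarrow> real" where
  "Hinf_norm \<phi> = (SUP z\<in>unit_disc. cmod (\<phi> z))"

text \<open>For \<open>f\<close> in \<open>H2\<close> the product vanishes outside the disc, whatever \<open>\<phi>\<close> does there.\<close>

definition mult_op :: "(complex \<Rightarrow> complex) \<Rightarrow> (complex \<Rightarrow> complex) \<Rightarrow> complex \<Rightarrow> complex" where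
  "mult_op \<phi> f = (\<lambda>z. \<phi> z * f z)"

definition disc_comp :: "(complex \<Rightarrow> complex) \<Rightarrow> (complex \<Rightarrow> complex) \<Rightarrow> complex \<Rightarrow> complex" where
  "disc_comp f \<phi> = (\<lambda>z. if z \<in> unit_disc then f (\<phi> z) else 0)"

text \<open>Nontangential approach region with vertex \<open>\<zeta>\<close> on the unit circle and aperture \<open>M > 1\<close>.\<close>

definition stolz_region :: "complex \<Rightarrow> real \<Rightarrow> complex set" where
  "stolz_region \<zeta> M = {z \<in> unit_disc. cmod (z - \<zeta>) < M * (1 - cmod z)}"

definition nontangential_limit :: "(complex \<Rightarrow> complex) \<Rightarrow> complex \<Rightarrow> complex \<Rightarrow> bool" where
  "nontangential_limit f \<zeta> L \<longleftrightarrow> (\<forall>M>1. (f \<longlongrightarrow> L) (at \<zeta> within stolz_region \<zeta> M))"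

text \<open>Existence of the boundary value almost everywhere is part of the definition (for bounded
  holomorphic functions it is Fatou's theorem).\<close>

definition inner_function :: "(complex \<Rightarrow> complex) \<Rightarrow> bool" where
  "inner_function \<theta> \<longleftrightarrow> \<theta> \<in> Hinf \<and>
     (AE t in lebesgue_on {0..2 * pi}. \<exists>L. nontangential_limit \<theta> (cis t) L \<and> cmod L = 1)"

lemma sums_taylor_coeff:
  assumes "f holomorphic_on unit_disc" "z \<in> unit_disc"
  shows "(\<lambda>n. taylor_coeff f n * z ^ n) sums f z"
  using holomorphic_power_series[OF assms]
  by (simp add: taylor_coeff_def fps_expansion_def)

lemma taylor_coeff_diff:
  assumes "f holomorphic_on unit_disc" "g holomorphic_on unit_disc"
  shows "taylor_coeff (\<lambda>z. f z - g z) n = taylor_coeff f n - taylor_coeff g n"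
  using higher_deriv_diff[OF assms, of 0 n]
  by (simp add: taylor_coeff_def fps_expansion_def diff_divide_distrib)

lemma summable_square_add:
  fixes a b :: "nat \<Rightarrow> complex"
  assumes "summable (\<lambda>n. (cmod (a n))\<^sup>2)" "summable (\<lambda>n. (cmod (b n))\<^sup>2)"
  shows "summable (\<lambda>n. (cmod (a n + b n))\<^sup>2)"
proof (rule summable_comparison_test')
  show "summable (\<lambda>n. 2 * (cmod (a n))\<^sup>2 + 2 * (cmod (b n))\<^sup>2)"
    using assms by (intro summable_add summable_mult)
  fix n
  have "(cmod (a n + b n))\<^sup>2 \<le> (cmod (a n) + cmod (b n))\<^sup>2"
    by (intro power_mono norm_triangle_ineq norm_ge_zero)
  also have "\<dots> \<le> 2 * (cmod (a n))\<^sup>2 + 2 * (cmod (b n))\<^sup>2"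
    using zero_le_power2[of "cmod (a n) - cmod (b n)"]
    unfolding power2_diff power2_sum by linarith
  finally show "norm ((cmod (a n + b n))\<^sup>2) \<le> 2 * (cmod (a n))\<^sup>2 + 2 * (cmod (b n))\<^sup>2"
    by simp
qed

lemma l2_triangle:
  fixes a b :: "nat \<Rightarrow> complex"
  assumes a: "summable (\<lambda>n. (cmod (a n))\<^sup>2)" and b: "summable (\<lambda>n. (cmod (b n))\<^sup>2)"
  shows "sqrt (\<Sum>n. (cmod (a n + b n))\<^sup>2) \<le> sqrt (\<Sum>n. (cmod (a n))\<^sup>2) + sqrt (\<Sum>n. (cmod (b n))\<^sup>2)"
proof (rule LIMSEQ_le)
  show "(\<lambda>N. sqrt (\<Sum>n<N. (cmod (a n + b n))\<^sup>2)) \<longlonglongrightarrow> sqrt (\<Sum>n. (cmod (a n + b n))\<^sup>2)"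
    by (intro tendsto_real_sqrt summable_LIMSEQ summable_square_add a b)
  show "(\<lambda>N. sqrt (\<Sum>n<N. (cmod (a n))\<^sup>2) + sqrt (\<Sum>n<N. (cmod (b n))\<^sup>2))
          \<longlonglongrightarrow> sqrt (\<Sum>n. (cmod (a n))\<^sup>2) + sqrt (\<Sum>n. (cmod (b n))\<^sup>2)"
    by (intro tendsto_add tendsto_real_sqrt summable_LIMSEQ a b)
  have "sqrt (\<Sum>n<N. (cmod (a n + b n))\<^sup>2)
          \<le> sqrt (\<Sum>n<N. (cmod (a n))\<^sup>2) + sqrt (\<Sum>n<N. (cmod (b n))\<^sup>2)" for N
  proof -
    have "sqrt (\<Sum>n<N. (cmod (a n + b n))\<^sup>2) \<le> sqrt (\<Sum>n<N. (cmod (a n) + cmod (b n))\<^sup>2)"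
      by (intro real_sqrt_le_mono sum_mono power_mono norm_triangle_ineq norm_ge_zero)
    also have "\<dots> \<le> sqrt (\<Sum>n<N. (cmod (a n))\<^sup>2) + sqrt (\<Sum>n<N. (cmod (b n))\<^sup>2)"
      using L2_set_triangle_ineq[of "\<lambda>n. cmod (a n)" "\<lambda>n. cmod (b n)" "{..<N}"]
      by (simp add: L2_set_def)
    finally show ?thesis .
  qed
  then show "\<exists>N. \<forall>n\<ge>N. sqrt (\<Sum>k<n. (cmod (a k + b k))\<^sup>2)
          \<le> sqrt (\<Sum>k<n. (cmod (a k))\<^sup>2) + sqrt (\<Sum>k<n. (cmod (b k))\<^sup>2)"
    by blast
qed

lemma H2_diff:
  assumes "f \<in> H2" "g \<in> H2"
  shows "(\<lambda>z. f z - g z) \<in> H2"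
proof -
  have "summable (\<lambda>n. (cmod (taylor_coeff f n + - taylor_coeff g n))\<^sup>2)"
    using assms by (intro summable_square_add) (auto simp: H2_def)
  then show ?thesis
    using assms by (auto simp: H2_def taylor_coeff_diff intro!: holomorphic_intros)
qed

lemma H2_norm_nonneg:
  assumes "f \<in> H2"
  shows "0 \<le> H2_norm f"
  using assms by (auto simp: H2_norm_def H2_def intro!: suminf_nonneg)

lemma H2_norm_eq_0_iff:
  assumes "f \<in> H2"
  shows "H2_norm f = 0 \<longleftrightarrow> f = (\<lambda>z. 0)"
proof
  assume "H2_norm f = 0"
  then have "taylor_coeff f n = 0" for n
    using assms by (simp add: H2_norm_def H2_def suminf_eq_zero_iff)
  then have "f z = 0" for z
    using assms sums_taylor_coeff[of f z] by (cases "z \<in> unit_disc") (auto simp: H2_def sums_iff)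
  then show "f = (\<lambda>z. 0)" by blast
next
  assume "f = (\<lambda>z. 0)"
  moreover have "taylor_coeff (\<lambda>z. 0) n = 0" for n
    using taylor_coeff_diff[of "\<lambda>z. 0" "\<lambda>z. 0" n] by simp
  ultimately show "H2_norm f = 0" by (simp add: H2_norm_def)
qed

lemma Metric_space_H2: "Metric_space H2 H2_dist"
proof
  fix f g h :: "complex \<Rightarrow> complex"
  show "0 \<le> H2_dist f g"
    by (simp add: H2_dist_def H2_norm_nonneg H2_diff)
  show "H2_dist f g = H2_dist g f"
    by (auto simp: H2_dist_def H2_norm_def H2_def taylor_coeff_diff norm_minus_commute)
  show "H2_dist f g = 0 \<longleftrightarrow> f = g" if "f \<in> H2" "g \<in> H2"
    using that by (auto simp: H2_dist_def H2_norm_eq_0_iff H2_diff fun_eq_iff)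
  show "H2_dist f h \<le> H2_dist f g + H2_dist g h" if fgh: "f \<in> H2" "g \<in> H2" "h \<in> H2"
  proof -
    let ?a = "taylor_coeff (\<lambda>z. f z - g z)" and ?b = "taylor_coeff (\<lambda>z. g z - h z)"
    have "taylor_coeff (\<lambda>z. f z - h z) n = ?a n + ?b n" for n
      using fgh by (simp add: H2_def taylor_coeff_diff)
    moreover have "summable (\<lambda>n. (cmod (?a n))\<^sup>2)" "summable (\<lambda>n. (cmod (?b n))\<^sup>2)"
      using H2_diff[of f g] H2_diff[of g h] fgh by (simp_all add: H2_def)
    ultimately show ?thesis
      using l2_triangle[of ?a ?b] fgh by (simp add: H2_dist_def H2_norm_def)
  qed
qed

end

theory Submission
  imports Defs
begin

text \<open>
  If \<open>f\<close> lies in \<open>Y\<close>, then so do \<open>f \<circ> \<phi>\<close> and \<open>\<phi> (f \<circ> \<phi>) = (z f) \<circ> \<phi>\<close>, and the hypothesis on \<open>Y\<close>,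
  read backwards, puts \<open>z f\<close> into \<open>Y\<close>. Thus \<open>Y\<close> is invariant under multiplication by \<open>z\<close>, and the
  claim becomes Beurling's theorem. Its proof separates the algebra of the Hilbert space from the
  study of boundary values.

  On coefficient sequences (\<open>beurling_l2\<close>), choose a unit vector \<open>\<theta>\<close> in \<open>Y\<close> orthogonal to \<open>z Y\<close>.
  The functions \<open>z\<^sup>n \<theta>\<close> are orthonormal, so multiplication by \<open>\<theta>\<close> is an isometry of the Hardy space.
  The orthogonal complement of \<open>z Y\<close> in \<open>Y\<close> is a line: for a further unit vector \<open>\<eta>\<close> in it, orthogonal
  to \<open>\<theta>\<close>, the product \<open>\<theta> \<eta> = \<eta> \<theta>\<close> would be orthogonal to itself, although the isometry gives it
  norm 1. From this \<open>Y = \<theta> H2\<close> follows by dividing by \<open>z\<close> repeatedly. The isometry also shows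
  that all powers of \<open>\<theta>\<close> have norm 1, and since point evaluations are bounded, \<open>\<bar>\<theta>\<bar> \<le> 1\<close> on the disc
  (\<open>l2_fun_wandering_le_1\<close>).

  It remains to see that a function with \<open>\<bar>\<theta>\<bar> \<le> 1\<close> and norm 1 has nontangential boundary values of
  modulus 1 almost everywhere. Existence of the limits is Fatou's theorem
  (\<open>AE_nontangential_limit\<close>): polynomials have limits everywhere, and the error
  of approximation by Taylor polynomials is controlled in whole Stolz regions by a weak type
  inequality (\<open>nontangential_maximal_weak_type\<close>). The latter compares the Poisson kernel with
  averages over arcs (\<open>stolz_square_le\<close>) and bounds the set where averages are large by Vitali's
  covering lemma (\<open>maximal_inequality\<close>). The modulus is 1 because the integral means of \<open>\<bar>\<theta>\<bar>\<^sup>2\<close> over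
  circles of radius \<open>r\<close> tend to 1 as \<open>r\<close> tends to 1, while \<open>\<bar>\<theta>\<bar>\<^sup>2\<close> never exceeds 1.\<close>

section \<open>The Hilbert space of square summable sequences\<close>

lemma summable_l2_mult:
  fixes a b :: "nat \<Rightarrow> complex"
  assumes "summable (\<lambda>n. (cmod (a n))\<^sup>2)" "summable (\<lambda>n. (cmod (b n))\<^sup>2)"
  shows "summable (\<lambda>n. cmod (a n * b n))"
proof (rule summable_comparison_test')
  show "summable (\<lambda>n. (cmod (a n))\<^sup>2 + (cmod (b n))\<^sup>2)"
    using assms by (intro summable_add)
  fix n
  show "norm (cmod (a n * b n)) \<le> (cmod (a n))\<^sup>2 + (cmod (b n))\<^sup>2"
    using sum_squares_bound[of "cmod (a n)" "cmod (b n)"]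
      mult_nonneg_nonneg[OF norm_ge_zero[of "a n"] norm_ge_zero[of "b n"]]
    unfolding norm_mult real_norm_def abs_mult abs_norm_cancel by linarith
qed

text \<open>The Hardy space is studied through its coefficient sequences. As a type of their own these carry
  the classes of real inner product spaces and of complete spaces, whose metric theory then
  applies; multiplication by complex scalars is an additional operation.\<close>

typedef l2 = "{a :: nat \<Rightarrow> complex. summable (\<lambda>n. (cmod (a n))\<^sup>2)}"
  morphisms l2_nth Abs_l2
  by (rule exI[of _ "\<lambda>n. 0"]) simp

setup_lifting type_definition_l2

lemma summable_l2_nth: "summable (\<lambda>n. (cmod (l2_nth a n))\<^sup>2)"
  using l2_nth[of a] by simp

lemma l2_eqI: "(\<And>n. l2_nth a n = l2_nth b n) \<Longrightarrow> a = b"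
  by (simp add: l2_nth_inject[symmetric] fun_eq_iff)

lift_definition scaleC :: "complex \<Rightarrow> l2 \<Rightarrow> l2" (infixr "*\<^sub>C" 75) is "\<lambda>c a n. c * a n"
  by (simp add: norm_mult power_mult_distrib summable_mult)

definition cinner :: "l2 \<Rightarrow> l2 \<Rightarrow> complex" where
  "cinner a b = (\<Sum>n. l2_nth a n * cnj (l2_nth b n))"

lemma summable_cinner: "summable (\<lambda>n. l2_nth a n * cnj (l2_nth b n))"
  by (rule summable_norm_cancel, rule summable_l2_mult) (simp_all add: summable_l2_nth)

instantiation l2 :: real_vector
begin

lift_definition zero_l2 :: l2 is "\<lambda>n. 0" by simp

lift_definition plus_l2 :: "l2 \<Rightarrow> l2 \<Rightarrow> l2" is "\<lambda>a b n. a n + b n"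
  by (rule summable_square_add)

lift_definition uminus_l2 :: "l2 \<Rightarrow> l2" is "\<lambda>a n. - a n" by simp

definition minus_l2 :: "l2 \<Rightarrow> l2 \<Rightarrow> l2" where "a - b = a + - (b :: l2)"

definition scaleR_l2 :: "real \<Rightarrow> l2 \<Rightarrow> l2" where "r *\<^sub>R a = complex_of_real r *\<^sub>C (a :: l2)"

instance
proof
  fix a b c :: l2 and r s :: real
  show "a + b + c = a + (b + c)" "a + b = b + a" "0 + a = a" "- a + a = 0"
    by (rule l2_eqI, simp add: plus_l2.rep_eq uminus_l2.rep_eq zero_l2.rep_eq)+
  show "a - b = a + - b" by (simp add: minus_l2_def)
  show "r *\<^sub>R (a + b) = r *\<^sub>R a + r *\<^sub>R b" "(r + s) *\<^sub>R a = r *\<^sub>R a + s *\<^sub>R a"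
    "r *\<^sub>R s *\<^sub>R a = (r * s) *\<^sub>R a" "1 *\<^sub>R a = a"
    unfolding scaleR_l2_def
    by (rule l2_eqI, simp add: plus_l2.rep_eq scaleC.rep_eq algebra_simps)+
qed

end

declare plus_l2.rep_eq [simp] uminus_l2.rep_eq [simp] zero_l2.rep_eq [simp] scaleC.rep_eq [simp]

lemma l2_nth_minus [simp]: "l2_nth (a - b) n = l2_nth a n - l2_nth b n"
  by (simp add: minus_l2_def del: add_uminus_conv_diff)

lemma l2_nth_sum [simp]: "l2_nth (sum f A) n = (\<Sum>i\<in>A. l2_nth (f i) n)"
  by (induction A rule: infinite_finite_induct) auto

lemma cinner_commute: "cinner b a = cnj (cinner a b)"
  unfolding cinner_def bounded_linear.suminf[OF bounded_linear_cnj summable_cinner]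
  by (simp add: mult.commute)

lemma cinner_add_left: "cinner (a + b) c = cinner a c + cinner b c"
  unfolding cinner_def suminf_add[OF summable_cinner summable_cinner]
  by (simp add: distrib_right)

lemma cinner_scaleC_left: "cinner (r *\<^sub>C a) b = r * cinner a b"
  unfolding cinner_def suminf_mult[OF summable_cinner, symmetric]
  by (simp add: mult.assoc)

lemma Re_cinner_self: "Re (cinner a a) = (\<Sum>n. (cmod (l2_nth a n))\<^sup>2)"
  unfolding cinner_def bounded_linear.suminf[OF bounded_linear_Re summable_cinner]
  by (simp flip: complex_norm_square of_real_power)

instantiation l2 :: real_inner
begin

definition inner_l2 :: "l2 \<Rightarrow> l2 \<Rightarrow> real" where "inner a b = Re (cinner a b)"

definition norm_l2 :: "l2 \<Rightarrow> real" where "norm a = sqrt (inner a (a :: l2))"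

definition dist_l2 :: "l2 \<Rightarrow> l2 \<Rightarrow> real" where "dist a b = norm (a - (b :: l2))"

definition sgn_l2 :: "l2 \<Rightarrow> l2" where "sgn a = (a :: l2) /\<^sub>R norm a"

definition uniformity_l2 :: "(l2 \<times> l2) filter" where
  "uniformity = (INF e\<in>{0<..}. principal {(x, y :: l2). dist x y < e})"

definition open_l2 :: "l2 set \<Rightarrow> bool" where
  "open U \<longleftrightarrow> (\<forall>x\<in>U. \<forall>\<^sub>F (x', y) in uniformity. x' = x \<longrightarrow> y \<in> U)" for U :: "l2 set"

instance
proof
  fix a b c :: l2 and r s :: real
  show "sgn a = a /\<^sub>R norm a" "dist a b = norm (a - b)" "norm a = sqrt (inner a a)"
    by (simp_all only: sgn_l2_def dist_l2_def norm_l2_def)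
  show "uniformity = (INF e\<in>{0<..}. principal {(x, y :: l2). dist x y < e})"
    by (rule uniformity_l2_def)
  show "open U \<longleftrightarrow> (\<forall>x\<in>U. \<forall>\<^sub>F (x', y) in uniformity. x' = x \<longrightarrow> y \<in> U)" for U :: "l2 set"
    by (rule open_l2_def)
  show "inner a b = inner b a"
    by (simp add: inner_l2_def cinner_commute[of a b])
  show "inner (a + b) c = inner a c + inner b c"
    by (simp add: inner_l2_def cinner_add_left)
  show "inner (r *\<^sub>R a) b = r * inner a b"
    by (simp add: inner_l2_def scaleR_l2_def cinner_scaleC_left)
  have *: "inner a a = (\<Sum>n. (cmod (l2_nth a n))\<^sup>2)"
    unfolding inner_l2_def by (rule Re_cinner_self)
  show "0 \<le> inner a a"
    unfolding * by (rule suminf_nonneg[OF summable_l2_nth]) simp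
  have "inner a a = 0 \<longleftrightarrow> (\<forall>n. (cmod (l2_nth a n))\<^sup>2 = 0)"
    unfolding * by (rule suminf_eq_zero_iff[OF summable_l2_nth]) simp
  also have "\<dots> \<longleftrightarrow> a = 0"
    by (auto simp: zero_l2.rep_eq intro: l2_eqI)
  finally show "inner a a = 0 \<longleftrightarrow> a = 0" .
qed

end

lemma norm_l2_square: "(norm a)\<^sup>2 = (\<Sum>n. (cmod (l2_nth a n))\<^sup>2)"
  unfolding power2_norm_eq_inner[of a] inner_l2_def by (rule Re_cinner_self)

lemma norm_l2_eq: "norm a = sqrt (\<Sum>n. (cmod (l2_nth a n))\<^sup>2)"
  by (metis norm_l2_square norm_ge_zero real_sqrt_abs abs_of_nonneg)

lemma sum_l2_nth_le: "(\<Sum>n<N. (cmod (l2_nth a n))\<^sup>2) \<le> (norm a)\<^sup>2"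
  unfolding norm_l2_square by (intro sum_le_suminf summable_l2_nth) auto

lemma l2_nth_le_norm: "cmod (l2_nth a n) \<le> norm a"
proof -
  have "(cmod (l2_nth a n))\<^sup>2 \<le> (\<Sum>k<Suc n. (cmod (l2_nth a k))\<^sup>2)"
    by (rule member_le_sum) auto
  also have "\<dots> \<le> (norm a)\<^sup>2" by (rule sum_l2_nth_le)
  finally show ?thesis by (rule power2_le_imp_le) simp
qed

instance l2 :: complete_space
proof
  fix X :: "nat \<Rightarrow> l2"
  assume X: "Cauchy X"
  have "Cauchy (\<lambda>k. l2_nth (X k) n)" for n
  proof (rule metric_CauchyI)
    fix e :: real assume "e > 0"
    then obtain M where M: "\<And>m k. m \<ge> M \<Longrightarrow> k \<ge> M \<Longrightarrow> dist (X m) (X k) < e"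
      using metric_CauchyD[OF X] by blast
    have "dist (l2_nth (X m) n) (l2_nth (X k) n) < e" if "m \<ge> M" "k \<ge> M" for m k
      using M[OF that] l2_nth_le_norm[of "X m - X k" n] by (simp add: dist_norm)
    then show "\<exists>M. \<forall>m\<ge>M. \<forall>k\<ge>M. dist (l2_nth (X m) n) (l2_nth (X k) n) < e" by blast
  qed
  then obtain a where a: "\<And>n. (\<lambda>k. l2_nth (X k) n) \<longlonglongrightarrow> a n"
    unfolding Cauchy_convergent_iff convergent_def by metis
  \<comment> \<open>Finite sections are used because the candidate \<open>a\<close> is not yet known to be square summable.\<close>
  have ev: "\<exists>M. \<forall>m\<ge>M. \<forall>N. (\<Sum>n<N. (cmod (l2_nth (X m) n - a n))\<^sup>2) \<le> e\<^sup>2" if "e > 0" for e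
  proof -
    obtain M where M: "\<forall>m\<ge>M. \<forall>k\<ge>M. dist (X m) (X k) < e"
      using metric_CauchyD[OF X \<open>e > 0\<close>] by blast
    have "(\<Sum>n<N. (cmod (l2_nth (X m) n - a n))\<^sup>2) \<le> e\<^sup>2" if "m \<ge> M" for m N
    proof (rule LIMSEQ_le_const2)
      show "(\<lambda>k. \<Sum>n<N. (cmod (l2_nth (X m) n - l2_nth (X k) n))\<^sup>2)
          \<longlonglongrightarrow> (\<Sum>n<N. (cmod (l2_nth (X m) n - a n))\<^sup>2)"
        by (intro tendsto_intros a)
      have "(\<Sum>n<N. (cmod (l2_nth (X m) n - l2_nth (X k) n))\<^sup>2) \<le> e\<^sup>2" if "k \<ge> M" for k
      proof -
        have "norm (X m - X k) \<le> e"
          using M \<open>m \<ge> M\<close> that by (simp add: dist_norm less_imp_le)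
        then have "(norm (X m - X k))\<^sup>2 \<le> e\<^sup>2" by (intro power_mono) auto
        then show ?thesis using sum_l2_nth_le[of "X m - X k" N] by simp
      qed
      then show "\<exists>K. \<forall>k\<ge>K. (\<Sum>n<N. (cmod (l2_nth (X m) n - l2_nth (X k) n))\<^sup>2) \<le> e\<^sup>2"
        by blast
    qed
    then show ?thesis by blast
  qed
  obtain M where M: "\<And>N. (\<Sum>n<N. (cmod (l2_nth (X M) n - a n))\<^sup>2) \<le> 1\<^sup>2"
    using ev[OF zero_less_one] by blast
  have "summable (\<lambda>n. (cmod (l2_nth (X M) n - a n))\<^sup>2)"
    using M by (intro summableI_nonneg_bounded[where x="1\<^sup>2"]) auto
  then have "summable (\<lambda>n. (cmod (l2_nth (X M) n + - (l2_nth (X M) n - a n)))\<^sup>2)"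
    by (intro summable_square_add summable_l2_nth) (simp add: norm_minus_commute)
  then have "summable (\<lambda>n. (cmod (a n))\<^sup>2)" by simp
  then have b: "l2_nth (Abs_l2 a) = a"
    by (intro Abs_l2_inverse CollectI)
  define b where "b = Abs_l2 a"
  note b = b[folded b_def]
  have "X \<longlonglongrightarrow> b"
  proof (rule metric_LIMSEQ_I)
    fix e :: real assume "e > 0"
    then obtain M where M: "\<And>m N. m \<ge> M \<Longrightarrow> (\<Sum>n<N. (cmod (l2_nth (X m) n - a n))\<^sup>2) \<le> (e/2)\<^sup>2"
      using ev[OF half_gt_zero[OF \<open>e > 0\<close>]] by blast
    have "dist (X m) b < e" if "m \<ge> M" for m
    proof -
      have "(norm (X m - b))\<^sup>2 \<le> (e/2)\<^sup>2"
        unfolding norm_l2_square using M[OF that]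
        by (intro suminf_le_const summable_l2_nth) (simp add: b)
      then show ?thesis
        using \<open>e > 0\<close> power2_le_imp_le[of "norm (X m - b)" "e/2"] unfolding dist_norm by simp
    qed
    then show "\<exists>M. \<forall>m\<ge>M. dist (X m) b < e" by blast
  qed
  then show "convergent X" by (rule convergentI)
qed

instance l2 :: banach ..

section \<open>Complex inner product, evaluation and shift\<close>

lemma cinner_scaleC_right: "cinner a (r *\<^sub>C b) = cnj r * cinner a b"
  by (metis cinner_commute cinner_scaleC_left complex_cnj_cnj complex_cnj_mult)

lemma cinner_zero_left [simp]: "cinner 0 b = 0"
  by (simp add: cinner_def)

lemma cinner_sum_left: "cinner (sum f A) b = (\<Sum>i\<in>A. cinner (f i) b)"
  by (induction A rule: infinite_finite_induct) (simp_all add: cinner_add_left)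

text \<open>Multiplying the second argument by \<open>\<i>\<close> multiplies the complex inner product by \<open>- \<i>\<close>, so the real
  inner product alone determines the complex one. Continuity and orthogonality are transferred
  from the real to the complex inner product along this identity.\<close>

lemma cinner_eq_inner: "cinner a b = Complex (inner a b) (inner a (\<i> *\<^sub>C b))"
  by (simp add: complex_eq_iff inner_l2_def cinner_scaleC_right)

lemma cinner_self: "cinner a a = of_real ((norm a)\<^sup>2)"
proof -
  have "Im (cinner a a) = 0" using cinner_commute[of a a] by (simp add: complex_eq_iff)
  then show ?thesis unfolding power2_norm_eq_inner by (simp add: complex_eq_iff inner_l2_def)
qed

lemma tendsto_cinner_left: "(f \<longlongrightarrow> a) F \<Longrightarrow> ((\<lambda>x. cinner (f x) b) \<longlongrightarrow> cinner a b) F"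
  unfolding cinner_eq_inner Complex_eq by (intro tendsto_intros)

lemma norm_scaleC: "norm (c *\<^sub>C a) = cmod c * norm a"
proof -
  have "cinner (c *\<^sub>C a) (c *\<^sub>C a) = (c * cnj c) * cinner a a"
    by (simp add: cinner_scaleC_left cinner_scaleC_right)
  then have "complex_of_real ((norm (c *\<^sub>C a))\<^sup>2) = of_real ((cmod c * norm a)\<^sup>2)"
    unfolding cinner_self complex_norm_square[symmetric] by (simp add: power_mult_distrib)
  then have "(norm (c *\<^sub>C a))\<^sup>2 = (cmod c * norm a)\<^sup>2" using of_real_eq_iff by blast
  then show ?thesis by (rule power2_eq_imp_eq) auto
qed

text \<open>The real and the imaginary part are bounded separately, whence the factor 2.\<close>

lemma cinner_le_norm: "cmod (cinner a b) \<le> 2 * (norm a * norm b)"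
proof -
  have "cmod (cinner a b) \<le> \<bar>inner a b\<bar> + \<bar>inner a (\<i> *\<^sub>C b)\<bar>"
    using cmod_le[of "cinner a b"] by (simp add: cinner_eq_inner)
  also have "\<dots> \<le> norm a * norm b + norm a * norm (\<i> *\<^sub>C b)"
    by (intro add_mono Cauchy_Schwarz_ineq2)
  finally show ?thesis by (simp add: norm_scaleC)
qed

text \<open>The reproducing kernel at \<open>z\<close>: the inner product with it is the sum of the power series at \<open>z\<close>.
  Outside the disc it is set to 0, so that the function defined by a sequence vanishes there, as
  the elements of \<open>H2\<close> do.\<close>

lift_definition kernel :: "complex \<Rightarrow> l2" is "\<lambda>z n. if cmod z < 1 then cnj z ^ n else 0"
proof -
  fix z
  show "summable (\<lambda>n. (cmod (if cmod z < 1 then cnj z ^ n else 0))\<^sup>2)"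
  proof (cases "cmod z < 1")
    case True
    have "(cmod z)\<^sup>2 < 1" using True by (simp add: power_less_one_iff abs_square_less_1)
    then have "summable (\<lambda>n. ((cmod z)\<^sup>2) ^ n)" by (intro summable_geometric) simp
    then show ?thesis using True by (simp add: norm_power power_mult[symmetric] mult.commute)
  qed simp
qed

definition l2_fun :: "l2 \<Rightarrow> complex \<Rightarrow> complex" where
  "l2_fun a z = cinner a (kernel z)"

lemma l2_fun_sums: "cmod z < 1 \<Longrightarrow> (\<lambda>n. l2_nth a n * z ^ n) sums l2_fun a z"
  using summable_sums[OF summable_cinner[of a "kernel z"]]
  by (simp add: l2_fun_def cinner_def kernel.rep_eq)

lemma l2_fun_outside: "\<not> cmod z < 1 \<Longrightarrow> l2_fun a z = 0"
  by (simp add: l2_fun_def cinner_def kernel.rep_eq)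

lemma l2_fun_has_fps_expansion: "l2_fun a has_fps_expansion Abs_fps (l2_nth a)"
proof (rule has_fps_expansionI)
  have "eventually (\<lambda>z. z \<in> ball 0 1) (nhds (0 :: complex))"
    by (intro eventually_nhds_in_open) auto
  then show "eventually (\<lambda>u. (\<lambda>n. fps_nth (Abs_fps (l2_nth a)) n * u ^ n) sums l2_fun a u) (nhds 0)"
    by eventually_elim (simp add: l2_fun_sums)
qed

lemma l2_fun_holomorphic: "l2_fun a holomorphic_on unit_disc"
proof (rule power_series_holomorphic)
  show "(\<lambda>n. l2_nth a n * (z - 0) ^ n) sums l2_fun a z" if "z \<in> ball 0 1" for z
    using that by (simp add: l2_fun_sums)
qed

lemma taylor_coeff_l2_fun: "taylor_coeff (l2_fun a) n = l2_nth a n"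
proof -
  have "fps_expansion (l2_fun a) 0 = Abs_fps (l2_nth a)"
    by (rule fps_expansion_eqI[OF l2_fun_has_fps_expansion])
  then show ?thesis by (simp add: taylor_coeff_def)
qed

lemma l2_fun_inject: "(\<And>z. cmod z < 1 \<Longrightarrow> l2_fun a z = l2_fun b z) \<Longrightarrow> a = b"
proof -
  assume "\<And>z. cmod z < 1 \<Longrightarrow> l2_fun a z = l2_fun b z"
  then have "l2_fun a = l2_fun b" by (metis l2_fun_outside ext)
  then show "a = b" by (metis l2_eqI taylor_coeff_l2_fun)
qed

lemma l2_fun_scaleC [simp]: "l2_fun (c *\<^sub>C a) z = c * l2_fun a z"
  by (simp add: l2_fun_def cinner_scaleC_left)

lemma tendsto_l2_fun: "(f \<longlongrightarrow> a) F \<Longrightarrow> ((\<lambda>x. l2_fun (f x) z) \<longlongrightarrow> l2_fun a z) F"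
  unfolding l2_fun_def by (rule tendsto_cinner_left)

text \<open>Multiplication by \<open>z\<close>, expressed on coefficients.\<close>

lift_definition shift :: "l2 \<Rightarrow> l2" is "\<lambda>a n. case n of 0 \<Rightarrow> 0 | Suc m \<Rightarrow> a m"
  by (subst summable_Suc_iff[symmetric]) simp

lemma l2_nth_shift [simp]: "l2_nth (shift a) 0 = 0" "l2_nth (shift a) (Suc n) = l2_nth a n"
  by (simp_all add: shift.rep_eq)

lemma shift_add: "shift (a + b) = shift a + shift b"
  by (rule l2_eqI) (simp add: shift.rep_eq split: nat.split)

lemma shift_scaleC: "shift (c *\<^sub>C a) = c *\<^sub>C shift a"
  by (rule l2_eqI) (simp add: shift.rep_eq split: nat.split)

lemma shift_scaleR: "shift (c *\<^sub>R a) = c *\<^sub>R shift a"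
  by (simp add: scaleR_l2_def shift_scaleC)

lemma linear_shift: "linear shift"
  by (intro linearI shift_add shift_scaleR)

lemma cinner_shift [simp]: "cinner (shift a) (shift b) = cinner a b"
  unfolding cinner_def
  by (subst suminf_split_head[symmetric, OF summable_cinner, of "shift a" "shift b", simplified]) simp

lemma norm_shift [simp]: "norm (shift a) = norm a"
proof -
  have "complex_of_real ((norm (shift a))\<^sup>2) = of_real ((norm a)\<^sup>2)"
    unfolding cinner_self[symmetric] by simp
  then show ?thesis by (metis of_real_eq_iff norm_ge_zero power2_eq_imp_eq)
qed

lemma l2_fun_shift [simp]: "l2_fun (shift a) z = z * l2_fun a z"
proof (cases "cmod z < 1")
  case True
  have "(\<lambda>n. l2_nth (shift a) (Suc n) * z ^ Suc n) sums (z * l2_fun a z)"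
    using sums_mult[OF l2_fun_sums[OF True, of a], of z] by (simp add: algebra_simps)
  then have "(\<lambda>n. l2_nth (shift a) n * z ^ n) sums (z * l2_fun a z)"
    by (subst (asm) sums_Suc_iff) simp
  then show ?thesis using l2_fun_sums[OF True, of "shift a"] sums_unique2 by blast
qed (simp add: l2_fun_outside)

lemma l2_fun_shift_pow [simp]: "l2_fun ((shift ^^ n) a) z = z ^ n * l2_fun a z"
  by (induction n) simp_all

section \<open>Orthogonal projection\<close>

text \<open>A minimizing sequence for the distance from \<open>x\<close> is Cauchy by the parallelogram law, because the
  midpoint of two elements of \<open>S\<close> is again a competitor. Its limit \<open>p\<close> is a nearest point, and
  comparing \<open>p\<close> with \<open>p + c *\<^sub>R q\<close> for the best \<open>c\<close> shows that \<open>x - p\<close> is orthogonal to \<open>q\<close>.\<close>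

lemma orthogonal_projection_exists:
  fixes S :: "'a :: {real_inner, complete_space} set"
  assumes "subspace S" "closed S"
  obtains p where "p \<in> S" "\<And>s. s \<in> S \<Longrightarrow> inner (x - p) s = 0"
proof -
  define d where "d = (INF s\<in>S. (norm (x - s))\<^sup>2)"
  have "0 \<in> S" using \<open>subspace S\<close> by (rule subspace_0)
  have bdd: "bdd_below ((\<lambda>s. (norm (x - s))\<^sup>2) ` S)"
    by (rule bdd_belowI2[of _ 0]) auto
  have d_le: "d \<le> (norm (x - s))\<^sup>2" if "s \<in> S" for s
    unfolding d_def by (rule cINF_lower[OF bdd that])
  have "\<exists>s\<in>S. (norm (x - s))\<^sup>2 < d + 1 / Suc n" for n
  proof (rule ccontr)
    assume "\<not> ?thesis"
    then have "d + 1 / Suc n \<le> d"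
      unfolding d_def using \<open>0 \<in> S\<close> by (intro cINF_greatest) (auto simp: d_def not_less)
    then show False by (simp add: divide_le_0_iff)
  qed
  then obtain s where s: "\<And>n. s n \<in> S" and near: "\<And>n. (norm (x - s n))\<^sup>2 < d + 1 / Suc n"
    by metis
  have par: "(norm (s m - s n))\<^sup>2 \<le> 2 * (1 / Suc m) + 2 * (1 / Suc n)" for m n
  proof -
    have mid: "(1/2) *\<^sub>R (s m + s n) \<in> S"
      using s \<open>subspace S\<close> by (intro subspace_scale subspace_add)
    have "(norm (s m - s n))\<^sup>2 + 4 * (norm (x - (1/2) *\<^sub>R (s m + s n)))\<^sup>2
        = 2 * (norm (x - s m))\<^sup>2 + 2 * (norm (x - s n))\<^sup>2"
      by (simp add: power2_norm_eq_inner inner_diff_left inner_diff_right inner_add_left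
          inner_add_right inner_commute algebra_simps)
    then show ?thesis using d_le[OF mid] near[of m] near[of n] by linarith
  qed
  have "Cauchy s"
  proof (rule metric_CauchyI)
    fix e :: real assume "e > 0"
    obtain M where M: "4 / real (Suc M) < e\<^sup>2"
    proof -
      obtain M :: nat where "4 / e\<^sup>2 < M" using reals_Archimedean2 by blast
      then have "4 / real (Suc M) < e\<^sup>2"
        using \<open>e > 0\<close> by (simp add: field_simps add_strict_increasing)
      then show ?thesis by (rule that)
    qed
    have "dist (s m) (s n) < e" if "m \<ge> M" "n \<ge> M" for m n
    proof -
      have "1 / real (Suc m) \<le> 1 / real (Suc M)" "1 / real (Suc n) \<le> 1 / real (Suc M)"
        using that by (simp_all add: field_simps)
      then have "(norm (s m - s n))\<^sup>2 < e\<^sup>2" using par[of m n] M by linarith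
      then show ?thesis unfolding dist_norm using \<open>e > 0\<close> by (simp add: power2_less_imp_less)
    qed
    then show "\<exists>M. \<forall>m\<ge>M. \<forall>n\<ge>M. dist (s m) (s n) < e" by blast
  qed
  then obtain p where lim: "s \<longlonglongrightarrow> p" by (auto simp: Cauchy_convergent_iff convergent_def)
  have "p \<in> S" using \<open>closed S\<close> s lim closed_sequentially by blast
  have "(norm (x - p))\<^sup>2 \<le> d"
  proof (rule LIMSEQ_le)
    show "(\<lambda>n. (norm (x - s n))\<^sup>2) \<longlonglongrightarrow> (norm (x - p))\<^sup>2" by (intro tendsto_intros lim)
    show "(\<lambda>n. d + 1 / Suc n) \<longlonglongrightarrow> d"
      using tendsto_add[OF tendsto_const[of d] LIMSEQ_inverse_real_of_nat] by (simp add: field_simps)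
    show "\<exists>N. \<forall>n\<ge>N. (norm (x - s n))\<^sup>2 \<le> d + 1 / Suc n" using near less_imp_le by blast
  qed
  then have p_min: "(norm (x - p))\<^sup>2 \<le> (norm (x - q))\<^sup>2" if "q \<in> S" for q
    using d_le[OF that] by linarith
  show ?thesis
  proof (rule that[OF \<open>p \<in> S\<close>])
    fix q assume "q \<in> S"
    show "inner (x - p) q = 0"
    proof (cases "q = 0")
      case False
      then have q: "inner q q > 0" by simp
      \<comment> \<open>The coefficient of the projection of \<open>x - p\<close> to the line through \<open>q\<close>.\<close>
      define c where "c = inner (x - p) q / inner q q"
      have "p + c *\<^sub>R q \<in> S"
        using \<open>p \<in> S\<close> \<open>q \<in> S\<close> \<open>subspace S\<close> by (intro subspace_scale subspace_add)
      then have "(norm (x - p))\<^sup>2 \<le> (norm ((x - p) - c *\<^sub>R q))\<^sup>2"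
        using p_min by (simp add: algebra_simps)
      also have "\<dots> = (norm (x - p))\<^sup>2 - 2 * c * inner (x - p) q + c * c * inner q q"
        by (simp only: power2_norm_eq_inner inner_diff_left inner_diff_right inner_scaleR_left inner_scaleR_right)
           (simp add: inner_commute algebra_simps)
      also have "\<dots> = (norm (x - p))\<^sup>2 - (inner (x - p) q)\<^sup>2 / inner q q"
        using q by (simp add: c_def field_simps power2_eq_square)
      finally show ?thesis using q by (simp add: field_simps)
    qed simp
  qed
qed

section \<open>Invariant subspaces of the shift\<close>

lemma cinner_shift_pow [simp]: "cinner ((shift ^^ n) a) ((shift ^^ n) b) = cinner a b"
  by (induction n) simp_all

lemma scaleC_add_left: "(c + d) *\<^sub>C a = c *\<^sub>C a + d *\<^sub>C a"
  by (rule l2_eqI) (simp add: distrib_right)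

lemma scaleC_zero_left [simp]: "0 *\<^sub>C a = 0"
  by (rule l2_eqI) simp

lemma scaleC_one [simp]: "1 *\<^sub>C a = a"
  by (rule l2_eqI) simp

lemma scaleC_scaleC: "c *\<^sub>C d *\<^sub>C a = (c * d) *\<^sub>C a"
  by (rule l2_eqI) simp

text \<open>\<open>kernel 0\<close> is the constant function 1, so its shifts are the monomials.\<close>

lemma l2_nth_monomial: "l2_nth ((shift ^^ k) (kernel 0)) n = (if n = k then 1 else 0)"
proof (induction k arbitrary: n)
  case 0
  show ?case by (simp add: kernel.rep_eq)
next
  case (Suc k)
  then show ?case by (cases n) simp_all
qed

lemma l2_fun_sum: "l2_fun (sum f A) z = (\<Sum>i\<in>A. l2_fun (f i) z)"
  unfolding l2_fun_def by (rule cinner_sum_left)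

text \<open>For an honest boundary function the conditions say that \<open>\<bar>\<theta>\<bar>\<^sup>2\<close> has mean 1 on the circle and that
  its other Fourier coefficients vanish: this is what being inner means on the level of coefficients.\<close>

definition wandering :: "l2 \<Rightarrow> bool" where
  "wandering \<theta> \<longleftrightarrow> norm \<theta> = 1 \<and> (\<forall>n>0. cinner ((shift ^^ n) \<theta>) \<theta> = 0)"

text \<open>The product \<open>\<theta> g\<close> as a series of the functions \<open>z\<^sup>n \<theta>\<close>. It is meaningful for wandering \<open>\<theta>\<close>: then
  these functions are orthonormal and the series converges for every square summable \<open>g\<close>.\<close>

definition l2_mult :: "l2 \<Rightarrow> l2 \<Rightarrow> l2" where
  "l2_mult \<theta> g = (\<Sum>n. l2_nth g n *\<^sub>C (shift ^^ n) \<theta>)"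

lemma wandering_orthonormal:
  assumes "wandering \<theta>"
  shows "cinner ((shift ^^ n) \<theta>) ((shift ^^ m) \<theta>) = (if n = m then 1 else 0)"
proof -
  have *: "cinner ((shift ^^ (k + m)) \<theta>) ((shift ^^ m) \<theta>) = (if k = 0 then 1 else 0)" for k m
  proof -
    have "(shift ^^ (k + m)) \<theta> = (shift ^^ m) ((shift ^^ k) \<theta>)"
      by (simp add: add.commute[of k] funpow_add)
    then show ?thesis
      using assms by (simp add: wandering_def cinner_self)
  qed
  consider "n \<ge> m" | "m \<ge> n" by linarith
  then show ?thesis
  proof cases
    case 1
    then show ?thesis using *[of "n - m" m] by auto
  next
    case 2
    then show ?thesis
      using *[of "m - n" n] cinner_commute[of "(shift ^^ n) \<theta>" "(shift ^^ m) \<theta>"] by auto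
  qed
qed

text \<open>Pythagoras for the orthonormal functions \<open>z\<^sup>n \<theta>\<close>.\<close>

lemma norm_wandering_sum:
  assumes "wandering \<theta>" "finite F"
  shows "(norm (\<Sum>n\<in>F. l2_nth g n *\<^sub>C (shift ^^ n) \<theta>))\<^sup>2 = (\<Sum>n\<in>F. (cmod (l2_nth g n))\<^sup>2)"
proof -
  let ?s = "\<Sum>n\<in>F. l2_nth g n *\<^sub>C (shift ^^ n) \<theta>"
  have *: "cinner ((shift ^^ m) \<theta>) ?s = cnj (l2_nth g m)" if "m \<in> F" for m
  proof -
    have "cinner ?s ((shift ^^ m) \<theta>) = (\<Sum>n\<in>F. if n = m then l2_nth g n else 0)"
      unfolding cinner_sum_left cinner_scaleC_left wandering_orthonormal[OF assms(1)]
      by (intro sum.cong) auto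
    also have "\<dots> = l2_nth g m" using assms(2) that by simp
    finally show ?thesis by (metis cinner_commute)
  qed
  have "cinner ?s ?s = (\<Sum>n\<in>F. l2_nth g n * cinner ((shift ^^ n) \<theta>) ?s)"
    by (subst cinner_sum_left) (simp only: cinner_scaleC_left)
  also have "\<dots> = (\<Sum>n\<in>F. of_real ((cmod (l2_nth g n))\<^sup>2))"
    unfolding complex_norm_square by (intro sum.cong) (simp_all add: *)
  finally show ?thesis
    unfolding cinner_self of_real_sum[symmetric] of_real_eq_iff .
qed

lemma l2_mult_sums:
  assumes "wandering \<theta>"
  shows "(\<lambda>n. l2_nth g n *\<^sub>C (shift ^^ n) \<theta>) sums l2_mult \<theta> g"
proof -
  have "summable (\<lambda>n. l2_nth g n *\<^sub>C (shift ^^ n) \<theta>)"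
    unfolding summable_Cauchy
  proof (intro allI impI)
    fix e :: real assume "e > 0"
    then have "e\<^sup>2 > 0" by simp
    then obtain N where N: "\<And>m n. m \<ge> N \<Longrightarrow> norm (\<Sum>k=m..<n. (cmod (l2_nth g k))\<^sup>2) < e\<^sup>2"
      using summable_l2_nth[of g] unfolding summable_Cauchy by blast
    have "norm (\<Sum>k=m..<n. l2_nth g k *\<^sub>C (shift ^^ k) \<theta>) < e" if "m \<ge> N" for m n
    proof (rule power2_less_imp_less)
      show "(norm (\<Sum>k=m..<n. l2_nth g k *\<^sub>C (shift ^^ k) \<theta>))\<^sup>2 < e\<^sup>2"
        unfolding norm_wandering_sum[OF assms finite_atLeastLessThan]
        using N[OF that, of n] by simp
    qed (use \<open>e > 0\<close> in simp)
    then show "\<exists>N. \<forall>m\<ge>N. \<forall>n. norm (\<Sum>k=m..<n. l2_nth g k *\<^sub>C (shift ^^ k) \<theta>) < e" by blast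
  qed
  then show ?thesis unfolding l2_mult_def by (rule summable_sums)
qed

lemma norm_l2_mult:
  assumes "wandering \<theta>"
  shows "norm (l2_mult \<theta> g) = norm g"
proof -
  have "(\<lambda>N. (norm (\<Sum>n<N. l2_nth g n *\<^sub>C (shift ^^ n) \<theta>))\<^sup>2) \<longlonglongrightarrow> (norm (l2_mult \<theta> g))\<^sup>2"
    using l2_mult_sums[OF assms, of g] unfolding sums_def by (intro tendsto_intros)
  moreover have "(\<lambda>N. (norm (\<Sum>n<N. l2_nth g n *\<^sub>C (shift ^^ n) \<theta>))\<^sup>2) \<longlonglongrightarrow> (norm g)\<^sup>2"
    unfolding norm_wandering_sum[OF assms finite_lessThan] norm_l2_square[of g]
    by (rule summable_LIMSEQ[OF summable_l2_nth])
  ultimately have "(norm (l2_mult \<theta> g))\<^sup>2 = (norm g)\<^sup>2" by (rule LIMSEQ_unique)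
  then show ?thesis by (rule power2_eq_imp_eq) auto
qed

text \<open>Evaluation at \<open>z\<close> is continuous, so it may be applied to the partial sums of the series, where
  the identity holds because every shift multiplies the values at \<open>z\<close> by \<open>z\<close>.\<close>

lemma l2_fun_mult:
  assumes "wandering \<theta>"
  shows "l2_fun (l2_mult \<theta> g) z = l2_fun \<theta> z * l2_fun g z"
proof (cases "cmod z < 1")
  case True
  have "(\<lambda>N. l2_fun (\<Sum>n<N. l2_nth g n *\<^sub>C (shift ^^ n) \<theta>) z) \<longlonglongrightarrow> l2_fun (l2_mult \<theta> g) z"
    using l2_mult_sums[OF assms, of g] unfolding sums_def by (rule tendsto_l2_fun)
  moreover have "l2_fun (\<Sum>n<N. l2_nth g n *\<^sub>C (shift ^^ n) \<theta>) z
      = l2_fun \<theta> z * (\<Sum>n<N. l2_nth g n * z ^ n)" for N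
    by (simp add: l2_fun_sum sum_distrib_left algebra_simps)
  moreover have "(\<lambda>N. l2_fun \<theta> z * (\<Sum>n<N. l2_nth g n * z ^ n)) \<longlonglongrightarrow> l2_fun \<theta> z * l2_fun g z"
    using l2_fun_sums[OF True, of g] unfolding sums_def by (rule tendsto_mult_left)
  ultimately show ?thesis using LIMSEQ_unique by auto
qed (simp add: l2_fun_outside)

lemma linear_l2_mult:
  assumes "wandering \<theta>"
  shows "linear (l2_mult \<theta>)"
proof (rule linearI)
  fix a b and r :: real
  have "(\<lambda>n. l2_nth (a + b) n *\<^sub>C (shift ^^ n) \<theta>) sums (l2_mult \<theta> a + l2_mult \<theta> b)"
    using sums_add[OF l2_mult_sums[OF assms, of a] l2_mult_sums[OF assms, of b]]
    by (simp add: scaleC_add_left)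
  then show "l2_mult \<theta> (a + b) = l2_mult \<theta> a + l2_mult \<theta> b"
    using l2_mult_sums[OF assms] sums_unique2 by blast
  have "(\<lambda>n. l2_nth (r *\<^sub>R a) n *\<^sub>C (shift ^^ n) \<theta>) sums (r *\<^sub>R l2_mult \<theta> a)"
    using sums_scaleR_right[OF l2_mult_sums[OF assms, of a], of r]
    by (simp add: scaleR_l2_def scaleC_scaleC)
  then show "l2_mult \<theta> (r *\<^sub>R a) = r *\<^sub>R l2_mult \<theta> a"
    using l2_mult_sums[OF assms] sums_unique2 by blast
qed

lemma l2_mult_scaleC:
  assumes "wandering \<theta>"
  shows "l2_mult \<theta> (c *\<^sub>C a) = c *\<^sub>C l2_mult \<theta> a"
  by (rule l2_fun_inject) (simp add: l2_fun_mult[OF assms])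

text \<open>The two series have little in common as elements of \<open>l2\<close>, but both sum to the pointwise product
  of the two functions.\<close>

lemma l2_mult_commute:
  assumes "wandering \<theta>" "wandering g"
  shows "l2_mult \<theta> g = l2_mult g \<theta>"
  by (rule l2_fun_inject) (simp add: l2_fun_mult assms mult.commute)

lemma cinner_l2_mult_left_eq_0:
  assumes "wandering \<theta>" "\<And>n. cinner ((shift ^^ n) \<theta>) b = 0"
  shows "cinner (l2_mult \<theta> g) b = 0"
proof -
  have "(\<lambda>N. cinner (\<Sum>n<N. l2_nth g n *\<^sub>C (shift ^^ n) \<theta>) b) \<longlonglongrightarrow> cinner (l2_mult \<theta> g) b"
    using l2_mult_sums[OF assms(1), of g] unfolding sums_def by (rule tendsto_cinner_left)
  then have "(\<lambda>N. 0) \<longlonglongrightarrow> cinner (l2_mult \<theta> g) b"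
    unfolding cinner_sum_left cinner_scaleC_left assms(2) by simp
  then show ?thesis by (simp add: LIMSEQ_const_iff)
qed

text \<open>Orthogonality passes to the closed span of the functions \<open>z\<^sup>n \<theta>\<close>, and then to that of the \<open>z\<^sup>m \<eta>\<close>.\<close>

lemma cinner_l2_mult_eq_0:
  assumes "wandering \<theta>" "wandering \<eta>" "\<And>n m. cinner ((shift ^^ n) \<theta>) ((shift ^^ m) \<eta>) = 0"
  shows "cinner (l2_mult \<theta> g) (l2_mult \<eta> h) = 0"
proof (rule cinner_l2_mult_left_eq_0[OF assms(1)])
  fix n
  have "cinner (l2_mult \<eta> h) ((shift ^^ n) \<theta>) = 0"
    by (rule cinner_l2_mult_left_eq_0[OF assms(2)]) (metis assms(3) cinner_commute complex_cnj_zero)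
  then show "cinner ((shift ^^ n) \<theta>) (l2_mult \<eta> h) = 0" by (metis cinner_commute complex_cnj_zero)
qed

text \<open>The preimages of a convergent sequence under an isometry form a Cauchy sequence, so they
  converge by completeness.\<close>

lemma closed_isometric_range:
  fixes T :: "'a :: banach \<Rightarrow> 'b :: real_normed_vector"
  assumes "linear T" "\<And>a. norm (T a) = norm a" "closed Y"
  shows "closed (T ` Y)"
  unfolding closed_sequential_limits
proof (intro allI impI, elim conjE)
  fix x l assume x: "\<forall>n. x n \<in> T ` Y" and l: "x \<longlonglongrightarrow> l"
  from x have "\<exists>y. \<forall>n. y n \<in> Y \<and> x n = T (y n)" by (intro choice) blast
  then obtain y where y: "\<And>n. y n \<in> Y" "\<And>n. x n = T (y n)" by blast
  have iso: "dist (T a) (T b) = dist a b" for a b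
    using assms(2)[of "a - b"] linear_diff[OF assms(1)] by (simp add: dist_norm)
  have "Cauchy x" using l by (rule LIMSEQ_imp_Cauchy)
  then have "Cauchy y" unfolding Cauchy_def y(2) iso .
  then obtain b where b: "y \<longlonglongrightarrow> b" unfolding Cauchy_convergent_iff convergent_def ..
  then have "b \<in> Y" using \<open>closed Y\<close> y(1) closed_sequentially by blast
  have "x \<longlonglongrightarrow> T b"
    using b unfolding tendsto_dist_iff[of y] tendsto_dist_iff[of x] y(2) iso .
  then show "l \<in> T ` Y" using l \<open>b \<in> Y\<close> LIMSEQ_unique by blast
qed

text \<open>If \<open>M\<close> is closed under complex scalars, orthogonality to \<open>s\<close> and to \<open>\<i> *\<^sub>C s\<close> in the real sense is
  orthogonality in the complex sense.\<close>

lemma complex_orthogonal_projection: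
  assumes "subspace M" "closed M" "\<And>c a. a \<in> M \<Longrightarrow> c *\<^sub>C a \<in> M"
  obtains p where "p \<in> M" "\<And>s. s \<in> M \<Longrightarrow> cinner (x - p) s = 0"
proof -
  obtain p where p: "p \<in> M" "\<And>s. s \<in> M \<Longrightarrow> inner (x - p) s = 0"
    using orthogonal_projection_exists[OF assms(1,2)] by blast
  have "cinner (x - p) s = 0" if "s \<in> M" for s
    unfolding cinner_eq_inner using p(2)[OF that] p(2)[OF assms(3)[OF that]]
    by (simp add: complex_eq_iff)
  then show ?thesis using that p(1) by blast
qed

text \<open>This is the Wold decomposition of the shift on \<open>Y\<close>. Let \<open>W\<close> be the part of \<open>Y\<close> orthogonal to
  \<open>z Y\<close>. It is nonzero, since a function that can be divided by \<open>z\<close> within \<open>Y\<close> again and again is 0.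
  A unit vector \<open>\<theta>\<close> of \<open>W\<close> is wandering, and \<open>z\<^sup>n u\<close> is orthogonal to \<open>z\<^sup>m v\<close> for
  \<open>u\<close>, \<open>v\<close> in \<open>W\<close> and different exponents. The point of the proof is that \<open>W\<close> is a line: a unit vector \<open>u\<close> of \<open>W\<close>
  orthogonal to \<open>\<theta>\<close> would have \<open>u H2\<close> orthogonal to \<open>\<theta> H2\<close>, although \<open>u \<theta> = \<theta> u\<close> lies in both and
  has norm 1. Finally, an element of \<open>Y\<close> orthogonal to \<open>\<theta> H2\<close> has no component in \<open>W\<close>, hence is
  divisible by \<open>z\<close> within the elements of this kind, and is therefore 0.\<close>

theorem beurling_l2:
  assumes "closed Y" and zero: "0 \<in> Y" and add: "\<And>a b. a \<in> Y \<Longrightarrow> b \<in> Y \<Longrightarrow> a + b \<in> Y"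
    and scale: "\<And>c a. a \<in> Y \<Longrightarrow> c *\<^sub>C a \<in> Y"
    and shift: "\<And>a. a \<in> Y \<Longrightarrow> shift a \<in> Y" and nonzero: "Y \<noteq> {0}"
  obtains \<theta> where "wandering \<theta>" "Y = range (l2_mult \<theta>)"
proof -
  have subspace: "subspace Y"
    unfolding subspace_def scaleR_l2_def by (intro conjI ballI allI zero add scale)
  have shift_pow: "(shift ^^ n) a \<in> Y" if "a \<in> Y" for n a
    by (induction n) (simp_all add: that shift)
  define W where "W = {w \<in> Y. \<forall>y\<in>Y. cinner w (shift y) = 0}"
  have W_Y: "w \<in> Y" if "w \<in> W" for w using that by (simp add: W_def)
  have split: "\<exists>w\<in>W. \<exists>y\<in>Y. f = w + shift y" if "f \<in> Y" for f
  proof -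
    have sub: "subspace (shift ` Y)" by (rule linear_subspace_image[OF linear_shift subspace])
    have cl: "closed (shift ` Y)"
      by (rule closed_isometric_range[OF linear_shift _ \<open>closed Y\<close>]) simp
    have sc: "c *\<^sub>C a \<in> shift ` Y" if a: "a \<in> shift ` Y" for c a
    proof -
      obtain b where "b \<in> Y" "a = shift b" using a by blast
      then show ?thesis using scale[of b c] by (simp flip: shift_scaleC)
    qed
    obtain p where p: "p \<in> shift ` Y" "\<And>s. s \<in> shift ` Y \<Longrightarrow> cinner (f - p) s = 0"
      using complex_orthogonal_projection[OF sub cl sc, of f] by metis
    then obtain y where y: "y \<in> Y" "p = shift y" by blast
    have "f - p \<in> Y" using subspace_diff[OF subspace \<open>f \<in> Y\<close>] shift y by blast
    then have "f - p \<in> W" using p(2) by (simp add: W_def)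
    then show ?thesis using y by (intro bexI[of _ "f - p"] bexI[of _ y]) auto
  qed
  have orth: "cinner ((shift ^^ (Suc k + m)) u) ((shift ^^ m) v) = 0" if "u \<in> Y" "v \<in> W" for k m u v
  proof -
    have "(shift ^^ (Suc k + m)) u = (shift ^^ m) (shift ((shift ^^ k) u))"
      by (simp add: add.commute[of _ m] funpow_add funpow_swap1 del: add_Suc add_Suc_right)
    then have "cinner ((shift ^^ (Suc k + m)) u) ((shift ^^ m) v) = cinner (shift ((shift ^^ k) u)) v"
      by simp
    also have "\<dots> = cnj (cinner v (shift ((shift ^^ k) u)))" by (rule cinner_commute)
    also have "\<dots> = 0" using that shift_pow by (simp add: W_def)
    finally show ?thesis .
  qed
  have wander: "wandering u" if "u \<in> W" "norm u = 1" for u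
    unfolding wandering_def using orth[OF W_Y[OF that(1)] that(1), of _ 0] that(2)
    by (metis Suc_pred add_0_right funpow_0)
  \<comment> \<open>A property that allows division by \<open>z\<close> indefinitely leaves no nonzero coefficient.\<close>
  have vanish: "r = 0" if step: "\<And>r. P r \<Longrightarrow> \<exists>y. r = shift y \<and> P y" and "P r" for P and r :: l2
  proof -
    have "\<forall>r. P r \<longrightarrow> l2_nth r n = 0" for n
    proof (induction n)
      case 0
      then show ?case using step by fastforce
    next
      case (Suc n)
      then show ?case using step by fastforce
    qed
    then show "r = 0" using \<open>P r\<close> by (intro l2_eqI) simp
  qed
  have normalize: "\<exists>u\<in>W. norm u = 1 \<and> (\<exists>c. u = c *\<^sub>C w)" if "w \<in> W" "w \<noteq> 0" for w
  proof (intro bexI conjI exI)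
    let ?u = "of_real (1 / norm w) *\<^sub>C w"
    show "norm ?u = 1" using that by (simp add: norm_scaleC norm_divide)
    show "?u \<in> W" using that scale by (simp add: W_def cinner_scaleC_left)
  qed simp
  have "\<exists>w\<in>W. w \<noteq> 0"
  proof (rule ccontr)
    assume "\<not> ?thesis"
    then have W0: "w = 0" if "w \<in> W" for w using that by blast
    have "\<exists>y. r = shift y \<and> y \<in> Y" if r: "r \<in> Y" for r
    proof -
      obtain w y where "w \<in> W" "y \<in> Y" "r = w + shift y" using split[OF r] by blast
      then show ?thesis using W0[of w] by auto
    qed
    then have "r = 0" if "r \<in> Y" for r using vanish[of "\<lambda>r. r \<in> Y"] that by blast
    then show False using nonzero zero by blast
  qed
  then obtain \<theta> where \<theta>: "\<theta> \<in> W" "norm \<theta> = 1" using normalize by blast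
  then have "wandering \<theta>" by (rule wander)
  have W_one_dim: "w = 0" if w: "w \<in> W" "cinner w \<theta> = 0" for w
  proof (rule ccontr)
    assume "w \<noteq> 0"
    then obtain u c where u: "u \<in> W" "norm u = 1" "u = c *\<^sub>C w" using normalize w(1) by blast
    have u\<theta>: "cinner u \<theta> = 0" using w u by (simp add: cinner_scaleC_left)
    have "wandering u" using u wander by blast
    have "cinner ((shift ^^ n) u) ((shift ^^ m) \<theta>) = 0" for n m
    proof -
      consider k where "n = Suc k + m" | k where "m = Suc k + n" | "n = m"
        by (metis add.commute less_imp_Suc_add linorder_neqE_nat add_Suc_right add_Suc)
      then show ?thesis
      proof cases
        case 1
        then show ?thesis using orth[OF W_Y[OF u(1)] \<theta>(1)] by simp
      next
        case (2 k)
        have "cinner ((shift ^^ m) \<theta>) ((shift ^^ n) u) = 0"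
          unfolding 2 by (rule orth[OF W_Y[OF \<theta>(1)] u(1)])
        then show ?thesis by (metis cinner_commute complex_cnj_zero)
      qed (simp add: u\<theta>)
    qed
    then have "cinner (l2_mult u \<theta>) (l2_mult \<theta> u) = 0"
      by (rule cinner_l2_mult_eq_0[OF \<open>wandering u\<close> \<open>wandering \<theta>\<close>])
    then have "cinner (l2_mult u \<theta>) (l2_mult u \<theta>) = 0"
      using l2_mult_commute[OF \<open>wandering u\<close> \<open>wandering \<theta>\<close>] by simp
    then show False by (simp add: cinner_self norm_l2_mult[OF \<open>wandering u\<close>] \<theta>(2))
  qed
  let ?M = "range (l2_mult \<theta>)"
  have "?M \<subseteq> Y"
  proof safe
    fix g
    have "(\<Sum>n<N. l2_nth g n *\<^sub>C (shift ^^ n) \<theta>) \<in> Y" for N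
      by (intro subspace_sum[OF subspace] scale shift_pow W_Y \<theta>(1))
    then show "l2_mult \<theta> g \<in> Y"
      by (rule closed_sequentially[OF \<open>closed Y\<close> _
          l2_mult_sums[OF \<open>wandering \<theta>\<close>, unfolded sums_def]])
  qed
  moreover have "Y \<subseteq> ?M"
  proof
    fix f assume "f \<in> Y"
    have sub: "subspace ?M"
      by (rule linear_subspace_image[OF linear_l2_mult[OF \<open>wandering \<theta>\<close>] subspace_UNIV])
    have cl: "closed ?M"
      using norm_l2_mult[OF \<open>wandering \<theta>\<close>]
      by (intro closed_isometric_range[OF linear_l2_mult[OF \<open>wandering \<theta>\<close>]]) auto
    have sc: "c *\<^sub>C a \<in> ?M" if "a \<in> ?M" for c a
      using that by (auto simp flip: l2_mult_scaleC[OF \<open>wandering \<theta>\<close>])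
    obtain p where p: "p \<in> ?M" "\<And>s. s \<in> ?M \<Longrightarrow> cinner (f - p) s = 0"
      using complex_orthogonal_projection[OF sub cl sc, of f] by metis
    have shift_in_M: "(shift ^^ k) \<theta> \<in> ?M" for k
    proof -
      let ?e = "(shift ^^ k) (kernel 0)"
      have "l2_mult \<theta> ?e = (\<Sum>n\<in>{k}. l2_nth ?e n *\<^sub>C (shift ^^ n) \<theta>)"
        unfolding l2_mult_def by (rule suminf_finite) (auto simp: l2_nth_monomial)
      also have "\<dots> = (shift ^^ k) \<theta>" by (simp add: l2_nth_monomial)
      finally show ?thesis by (metis rangeI)
    qed
    define P where "P r \<longleftrightarrow> r \<in> Y \<and> (\<forall>k. cinner r ((shift ^^ k) \<theta>) = 0)" for r
    have "\<exists>y. r = shift y \<and> P y" if "P r" for r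
    proof -
      obtain w y where wy: "w \<in> W" "y \<in> Y" "r = w + shift y" using split \<open>P r\<close> P_def by blast
      have "cinner (shift y) \<theta> = 0" using orth[OF wy(2) \<theta>(1), of 0 0] by simp
      moreover have "cinner r \<theta> = 0" using \<open>P r\<close> by (metis P_def funpow_0)
      ultimately have "cinner w \<theta> = 0" by (simp add: wy(3) cinner_add_left)
      then have "r = shift y" using W_one_dim wy by simp
      moreover have "cinner y ((shift ^^ k) \<theta>) = 0" for k
      proof -
        have "cinner r ((shift ^^ Suc k) \<theta>) = 0" using \<open>P r\<close> P_def by blast
        then show ?thesis by (simp add: \<open>r = shift y\<close>)
      qed
      ultimately show ?thesis using wy(2) P_def by blast
    qed
    moreover have "f - p \<in> Y" using p(1) \<open>?M \<subseteq> Y\<close> \<open>f \<in> Y\<close> subspace_diff[OF subspace] by blast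
    then have "P (f - p)" unfolding P_def using p(2) shift_in_M by blast
    ultimately have "f - p = 0" by (rule vanish)
    then show "f \<in> ?M" using p(1) by simp
  qed
  ultimately show ?thesis using that \<open>wandering \<theta>\<close> by blast
qed

text \<open>Multiplication by \<open>\<theta>\<close> preserves the norm, so all powers of \<open>\<theta>\<close> have norm 1. Their values at \<open>z\<close>,
  which are the powers of \<open>\<theta>(z)\<close>, stay bounded because evaluation at \<open>z\<close> is bounded.\<close>

lemma l2_fun_wandering_le_1:
  assumes "wandering \<theta>"
  shows "cmod (l2_fun \<theta> z) \<le> 1"
proof (rule ccontr)
  assume "\<not> ?thesis"
  then have gt: "cmod (l2_fun \<theta> z) > 1" by simp
  define T where "T n = ((l2_mult \<theta>) ^^ n) \<theta>" for n
  have "norm (T n) = 1" for n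
    by (induction n) (use assms in \<open>simp_all add: T_def norm_l2_mult wandering_def\<close>)
  moreover have "l2_fun (T n) z = l2_fun \<theta> z ^ Suc n" for n
    by (induction n) (simp_all add: T_def l2_fun_mult[OF assms])
  ultimately have "cmod (l2_fun \<theta> z) ^ Suc n \<le> 2 * norm (kernel z)" for n
    using cinner_le_norm[of "T n" "kernel z"] by (simp add: l2_fun_def norm_power norm_mult)
  moreover obtain n where "2 * norm (kernel z) < cmod (l2_fun \<theta> z) ^ n"
    using real_arch_pow[OF gt] by blast
  then have "2 * norm (kernel z) < cmod (l2_fun \<theta> z) ^ Suc n"
    using power_increasing[of n "Suc n" "cmod (l2_fun \<theta> z)"] gt by simp
  ultimately show False by (meson not_less)
qed

section \<open>Integrals over the unit circle\<close>

lemma has_integral_cis_int: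
  "((\<lambda>s. cis (of_int k * s)) has_integral (if k = 0 then of_real (2 * pi) else 0)) {0..2 * pi}"
proof (cases "k = 0")
  case True
  then show ?thesis using has_integral_const_real[of "1 :: complex" 0 "2 * pi"]
    by (simp add: scaleR_conv_of_real)
next
  case False
  let ?F = "\<lambda>s. cis (of_int k * s) / (\<i> * of_int k)"
  have "((\<lambda>s. cis (of_int k * s)) has_integral (?F (2 * pi) - ?F 0)) {0..2 * pi}"
  proof (rule fundamental_theorem_of_calculus)
    fix s
    show "(?F has_vector_derivative cis (of_int k * s)) (at s within {0..2 * pi})"
      unfolding has_vector_derivative_def using False
      by (auto intro!: derivative_eq_intros simp: scaleR_conv_of_real fun_eq_iff mult.left_commute[of "complex_of_real _" \<i>])
  qed simp
  moreover have "cis (of_int k * (2 * pi)) = 1"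
    using cis_multiple_2pi[of "of_int k"] by (simp add: mult.commute mult.left_commute)
  ultimately show ?thesis using False by simp
qed

lemma parseval_trigonometric_polynomial:
  "((\<lambda>s. (cmod (\<Sum>n<N. a n * cis (real n * s)))\<^sup>2) has_integral 2 * pi * (\<Sum>n<N. (cmod (a n))\<^sup>2))
     {0..2 * pi}"
proof -
  have "((\<lambda>s. \<Sum>n<N. \<Sum>m<N. (a n * cnj (a m)) * cis (of_int (int n - int m) * s)) has_integral
      (\<Sum>n<N. \<Sum>m<N. (a n * cnj (a m)) * (if int n - int m = 0 then of_real (2 * pi) else 0))) {0..2 * pi}"
    by (intro has_integral_sum finite_lessThan has_integral_mult_right has_integral_cis_int)
  also have "(\<lambda>s. \<Sum>n<N. \<Sum>m<N. (a n * cnj (a m)) * cis (of_int (int n - int m) * s))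
      = (\<lambda>s. of_real ((cmod (\<Sum>n<N. a n * cis (real n * s)))\<^sup>2))"
  proof
    fix s
    have "cis (of_int (int n - int m) * s) = cis (real n * s) * cnj (cis (real m * s))" for n m
      by (simp add: cis_mult cis_cnj left_diff_distrib)
    then show "(\<Sum>n<N. \<Sum>m<N. (a n * cnj (a m)) * cis (of_int (int n - int m) * s))
        = of_real ((cmod (\<Sum>n<N. a n * cis (real n * s)))\<^sup>2)"
      unfolding complex_norm_square cnj_sum sum_product
      by (intro sum.cong refl) (simp add: mult_ac)
  qed
  also have "(\<Sum>n<N. \<Sum>m<N. (a n * cnj (a m)) * (if int n - int m = 0 then of_real (2 * pi) else 0))
      = of_real (2 * pi * (\<Sum>n<N. (cmod (a n))\<^sup>2))"
  proof -
    have "(\<Sum>m<N. (a n * cnj (a m)) * (if int n - int m = 0 then of_real (2 * pi) else 0))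
        = of_real (2 * pi * (cmod (a n))\<^sup>2)" if "n < N" for n
    proof -
      have "(\<Sum>m<N. (a n * cnj (a m)) * (if int n - int m = 0 then of_real (2 * pi) else 0))
          = (\<Sum>m<N. if m = n then a n * cnj (a n) * of_real (2 * pi) else 0)"
        by (intro sum.cong) auto
      also have "\<dots> = a n * cnj (a n) * of_real (2 * pi)" using that by simp
      also have "\<dots> = of_real (2 * pi * (cmod (a n))\<^sup>2)"
        unfolding of_real_mult complex_norm_square by simp
      finally show ?thesis .
    qed
    then show ?thesis unfolding sum_distrib_left of_real_sum by (intro sum.cong) auto
  qed
  finally have "((\<lambda>s. complex_of_real ((cmod (\<Sum>n<N. a n * cis (real n * s)))\<^sup>2)) has_integral
      of_real (2 * pi * (\<Sum>n<N. (cmod (a n))\<^sup>2))) {0..2 * pi}" .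
  from has_integral_linear[OF this bounded_linear_Re] show ?thesis by (simp only: o_def Re_complex_of_real)
qed

text \<open>Absolute summability of the coefficients makes the partial sums converge uniformly, so that the
  identity for trigonometric polynomials passes to the limit.\<close>

lemma parseval_circle:
  assumes "summable (\<lambda>n. cmod (a n))" "summable (\<lambda>n. (cmod (a n))\<^sup>2)"
  shows "((\<lambda>s. (cmod (\<Sum>n. a n * cis (real n * s)))\<^sup>2) has_integral 2 * pi * (\<Sum>n. (cmod (a n))\<^sup>2))
     {0..2 * pi}"
proof -
  let ?P = "\<lambda>N s. \<Sum>n<N. a n * cis (real n * s)" and ?F = "\<lambda>s. \<Sum>n. a n * cis (real n * s)"
  have lim: "uniform_limit {0..2 * pi} ?P ?F sequentially"
    by (rule Weierstrass_m_test[OF _ assms(1)]) (simp add: norm_mult)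
  have cont_P: "continuous_on {0..2 * pi} (?P N)" for N
    by (intro continuous_intros)
  have cont_F: "continuous_on {0..2 * pi} ?F"
    by (rule uniform_limit_theorem[OF always_eventually lim]) (simp_all add: cont_P)
  have bdd: "bounded ((\<lambda>s. cmod (?F s)) ` {0..2 * pi})"
    by (intro compact_imp_bounded compact_continuous_image continuous_intros cont_F) auto
  have "uniform_limit {0..2 * pi} (\<lambda>N s. cmod (?P N s) * cmod (?P N s))
      (\<lambda>s. cmod (?F s) * cmod (?F s)) sequentially"
    by (intro uniform_lim_mult uniform_limit_norm lim bdd)
  then obtain I J where IJ: "\<And>N. ((\<lambda>s. cmod (?P N s) * cmod (?P N s)) has_integral I N) {0..2 * pi}"
      "((\<lambda>s. cmod (?F s) * cmod (?F s)) has_integral J) {0..2 * pi}" "I \<longlonglongrightarrow> J"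
    by (rule uniform_limit_integral) (auto intro!: continuous_intros cont_P)
  have "I = (\<lambda>N. 2 * pi * (\<Sum>n<N. (cmod (a n))\<^sup>2))"
  proof
    fix N
    show "I N = 2 * pi * (\<Sum>n<N. (cmod (a n))\<^sup>2)"
      using IJ(1)[of N] parseval_trigonometric_polynomial[of a N]
      unfolding power2_eq_square by (rule has_integral_unique)
  qed
  then have "I \<longlonglongrightarrow> 2 * pi * (\<Sum>n. (cmod (a n))\<^sup>2)"
    by (simp only:) (intro tendsto_mult_left summable_LIMSEQ assms(2))
  then have "J = 2 * pi * (\<Sum>n. (cmod (a n))\<^sup>2)" using IJ(3) LIMSEQ_unique by blast
  then show ?thesis using IJ(2) by (simp add: power2_eq_square)
qed

lemma parseval_l2_fun:
  assumes "0 \<le> r" "r < 1"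
  shows "((\<lambda>s. (cmod (l2_fun b (of_real r * cis s)))\<^sup>2) has_integral
      2 * pi * (\<Sum>n. (cmod (l2_nth b n))\<^sup>2 * (r\<^sup>2) ^ n)) {0..2 * pi}"
proof -
  let ?a = "\<lambda>n. l2_nth b n * of_real r ^ n"
  have "r\<^sup>2 < 1" using assms by (simp add: abs_square_less_1)
  then have geo: "summable (\<lambda>n. (r\<^sup>2) ^ n)" by (intro summable_geometric) simp
  have norm_a: "(cmod (?a n))\<^sup>2 = (cmod (l2_nth b n))\<^sup>2 * (r\<^sup>2) ^ n" for n
    using assms by (simp add: norm_mult norm_power power_mult_distrib power_mult[symmetric] mult.commute)
  have s1: "summable (\<lambda>n. cmod (?a n))"
    by (rule summable_l2_mult[OF summable_l2_nth])
      (use geo assms in \<open>simp add: norm_power power_mult[symmetric] mult.commute\<close>)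
  have s2: "summable (\<lambda>n. (cmod (?a n))\<^sup>2)"
  proof (rule summable_comparison_test'[OF summable_l2_nth[of b]])
    fix n
    have "(r\<^sup>2) ^ n \<le> 1" using \<open>r\<^sup>2 < 1\<close> by (intro power_le_one[of "r\<^sup>2"]) auto
    then show "norm ((cmod (?a n))\<^sup>2) \<le> (cmod (l2_nth b n))\<^sup>2"
      unfolding norm_a by (simp add: mult_left_le)
  qed
  have "l2_fun b (of_real r * cis s) = (\<Sum>n. ?a n * cis (real n * s))" for s
  proof -
    have "cmod (of_real r * cis s) < 1" using assms by (simp add: norm_mult)
    from l2_fun_sums[OF this, of b] show ?thesis
      by (simp add: power_mult_distrib Complex.DeMoivre sums_iff mult.assoc)
  qed
  then show ?thesis using parseval_circle[OF s1 s2] by (simp add: norm_a)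
qed

lemma parseval_l2_fun_le:
  assumes "0 \<le> r" "r < 1"
  shows "integral {0..2 * pi} (\<lambda>s. (cmod (l2_fun b (of_real r * cis s)))\<^sup>2) \<le> 2 * pi * (norm b)\<^sup>2"
proof -
  have le: "(r\<^sup>2) ^ n \<le> 1" for n using assms by (intro power_le_one) (auto simp: abs_square_le_1)
  have "(\<Sum>n. (cmod (l2_nth b n))\<^sup>2 * (r\<^sup>2) ^ n) \<le> (\<Sum>n. (cmod (l2_nth b n))\<^sup>2)"
  proof (rule suminf_le)
    show "(cmod (l2_nth b n))\<^sup>2 * (r\<^sup>2) ^ n \<le> (cmod (l2_nth b n))\<^sup>2" for n
      using le by (simp add: mult_left_le)
    then show "summable (\<lambda>n. (cmod (l2_nth b n))\<^sup>2 * (r\<^sup>2) ^ n)"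
      by (intro summable_comparison_test'[OF summable_l2_nth[of b]]) simp
  qed (rule summable_l2_nth)
  then show ?thesis
    using integral_unique[OF parseval_l2_fun[OF assms, of b]] by (simp add: norm_l2_square)
qed

text \<open>Cauchy's formula for \<open>(g u)\<^sup>2\<close> times the factor \<open>(1 - \<bar>z\<bar>\<^sup>2) / (1 - cnj z * u)\<close>. The factor is
  1 at \<open>u = z\<close>, and on the circle it turns the Cauchy kernel into the Poisson kernel, which is
  positive and has integral \<open>2 * pi\<close> for every \<open>z\<close>. Working with \<open>g\<^sup>2\<close> instead of \<open>g\<close> bounds \<open>\<bar>g z\<bar>\<^sup>2\<close> by averages of \<open>\<bar>g\<bar>\<^sup>2\<close> without
  the Cauchy-Schwarz inequality.\<close>

lemma poisson_square_le:
  assumes cont: "continuous_on (cball 0 1) g" and holo: "g holomorphic_on ball 0 1" and z: "cmod z < 1"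
  shows "2 * pi * (cmod (g z))\<^sup>2
    \<le> integral {0..2 * pi} (\<lambda>s. (cmod (g (cis s)))\<^sup>2 * ((1 - (cmod z)\<^sup>2) / (cmod (cis s - z))\<^sup>2))"
proof -
  let ?f = "\<lambda>u. (g u)\<^sup>2 * (1 - (cmod z)\<^sup>2) / (1 - cnj z * u)"
  let ?k = "\<lambda>s. (1 - (cmod z)\<^sup>2) / (cmod (cis s - z))\<^sup>2"
  have nz: "1 - cnj z * u \<noteq> 0" if "cmod u \<le> 1" for u
  proof
    assume "1 - cnj z * u = 0"
    then have "cmod z * cmod u = 1" by (metis complex_mod_cnj eq_iff_diff_eq_0 norm_mult norm_one)
    moreover have "cmod z * cmod u \<le> cmod z * 1" using that by (intro mult_left_mono) auto
    ultimately show False using z by simp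
  qed
  have "((\<lambda>u. ?f u / (u - z)) has_contour_integral (2 * of_real pi * \<i> * ?f z)) (circlepath 0 1)"
    using nz z
    by (intro Cauchy_integral_circlepath continuous_intros holomorphic_intros cont holo) auto
  then have "((\<lambda>s. ?f (cis s) / (cis s - z) * \<i> * cis s) has_integral
      2 * of_real pi * \<i> * ?f z) {0..2 * pi}"
    unfolding circlepath_def has_contour_integral_part_circlepath_iff[OF mult_pos_pos[OF zero_less_numeral pi_gt_zero]]
    by simp
  also have "?f z = (g z)\<^sup>2"
  proof -
    have "1 - cnj z * z = of_real (1 - (cmod z)\<^sup>2)"
      unfolding of_real_diff complex_norm_square by (simp add: mult.commute)
    moreover have "1 - cnj z * z \<noteq> 0" using nz z by simp
    ultimately show ?thesis by simp
  qed
  also have "(\<lambda>s. ?f (cis s) / (cis s - z) * \<i> * cis s) = (\<lambda>s. \<i> * ((g (cis s))\<^sup>2 * of_real (?k s)))"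
  proof
    fix s
    have ne: "cis s - z \<noteq> 0" using z by (metis norm_cis eq_iff_diff_eq_0 less_irrefl)
    then have ne': "cnj (cis s - z) \<noteq> 0" by simp
    have "1 - cnj z * cis s = cis s * cnj (cis s - z)"
      by (simp add: algebra_simps flip: complex_norm_square)
    moreover have "G * K / (u * w) / d * \<i> * u = \<i> * (G * (K / (w * d)))"
      if "u \<noteq> 0" "w \<noteq> 0" "d \<noteq> 0" for u w d G K :: complex
      using that by (simp add: field_simps)
    ultimately have "?f (cis s) / (cis s - z) * \<i> * cis s
        = \<i> * ((g (cis s))\<^sup>2 * ((1 - (cmod z)\<^sup>2) / (cnj (cis s - z) * (cis s - z))))"
      using ne ne' cis_neq_zero[of s] by simp
    also have "cnj (cis s - z) * (cis s - z) = of_real ((cmod (cis s - z))\<^sup>2)"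
      unfolding complex_norm_square by (simp add: mult.commute)
    finally show "?f (cis s) / (cis s - z) * \<i> * cis s = \<i> * ((g (cis s))\<^sup>2 * of_real (?k s))"
      by (simp add: of_real_divide)
  qed
  finally have int: "((\<lambda>s. \<i> * ((g (cis s))\<^sup>2 * of_real (?k s))) has_integral
      2 * of_real pi * \<i> * (g z)\<^sup>2) {0..2 * pi}" .
  have cont_g: "continuous_on A (\<lambda>s. g (cis s))" for A
    by (rule continuous_on_compose2[OF cont]) (auto intro!: continuous_intros)
  have "norm (integral {0..2 * pi} (\<lambda>s. \<i> * ((g (cis s))\<^sup>2 * of_real (?k s))))
      \<le> integral {0..2 * pi} (\<lambda>s. (cmod (g (cis s)))\<^sup>2 * ?k s)"
  proof (rule integral_norm_bound_integral)
    show "(\<lambda>s. \<i> * ((g (cis s))\<^sup>2 * of_real (?k s))) integrable_on {0..2 * pi}"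
      using int by blast
    have "cis s - z \<noteq> 0" for s using z by (metis norm_cis eq_iff_diff_eq_0 less_irrefl)
    then show "(\<lambda>s. (cmod (g (cis s)))\<^sup>2 * ?k s) integrable_on {0..2 * pi}"
      by (intro integrable_continuous_interval continuous_intros cont_g) auto
    have "\<bar>1 - (cmod z)\<^sup>2\<bar> = 1 - (cmod z)\<^sup>2" using z by (simp add: abs_square_le_1)
    then show "norm (\<i> * ((g (cis s))\<^sup>2 * of_real (?k s))) \<le> (cmod (g (cis s)))\<^sup>2 * ?k s" for s
      by (simp only: norm_mult norm_ii norm_of_real norm_power abs_divide mult_1_left) simp
  qed
  then show ?thesis
    unfolding integral_unique[OF int] by (simp add: norm_mult norm_power)
qed

text \<open>Recentres the integral over a period at \<open>t\<close> and folds it, so that the integrand can be compared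
  with a kernel that depends only on the distance from \<open>t\<close>.\<close>

lemma integral_periodic:
  fixes q :: "real \<Rightarrow> real"
  assumes cont: "continuous_on UNIV q" and per: "\<And>s. q (s + 2 * pi) = q s" and t: "0 \<le> t" "t \<le> 2 * pi"
  shows "integral {0..2 * pi} q = integral {0..pi} (\<lambda>u. q (t + u) + q (t - u))"
proof -
  have int: "q integrable_on {a..b}" for a b
    by (intro integrable_continuous_interval continuous_on_subset[OF cont]) simp
  have shift: "integral {a + 2 * pi..b + 2 * pi} q = integral {a..b} q" for a b
    using integral_shift_Icc_real[of a b q "2 * pi"] per by (simp add: o_def add.commute)
  have window: "integral {c..c + 2 * pi} q = integral {0..2 * pi} q" if "0 \<le> c" "c \<le> 2 * pi" for c
  proof -
    have "integral {c..2 * pi} q + integral {2 * pi..c + 2 * pi} q = integral {c..c + 2 * pi} q"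
      using that by (intro Henstock_Kurzweil_Integration.integral_combine int) auto
    moreover have "integral {0..c} q + integral {c..2 * pi} q = integral {0..2 * pi} q"
      using that by (intro Henstock_Kurzweil_Integration.integral_combine int) auto
    moreover have "integral {2 * pi..c + 2 * pi} q = integral {0..c} q" using shift[of 0 c] by simp
    ultimately show ?thesis by linarith
  qed
  have "integral {t - pi..t + pi} q = integral {0..2 * pi} q"
  proof (cases "t \<ge> pi")
    case True
    then show ?thesis using window[of "t - pi"] t by (simp add: algebra_simps)
  next
    case False
    then have "integral {t + pi..t + pi + 2 * pi} q = integral {0..2 * pi} q"
      using t by (intro window) auto
    then show ?thesis using shift[of "t - pi" "t + pi"] by (simp add: algebra_simps)
  qed
  moreover have "integral {t - pi..t} q + integral {t..t + pi} q = integral {t - pi..t + pi} q"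
    by (intro Henstock_Kurzweil_Integration.integral_combine int) auto
  moreover have "integral {t..t + pi} q = integral {0..pi} (\<lambda>u. q (t + u))"
    using integral_shift_Icc_real[of 0 pi q t] by (simp add: o_def add.commute)
  moreover have "integral {t - pi..t} q = integral {0..pi} (\<lambda>u. q (t - u))"
    using integral_shift_Icc_real[of "- pi" 0 q t] Henstock_Kurzweil_Integration.integral_reflect_real[where a=0 and b=pi and f="\<lambda>u. q (t - u)"]
    by (simp add: o_def add.commute)
  moreover have "continuous_on {0..pi} (\<lambda>u. q (t + u))" "continuous_on {0..pi} (\<lambda>u. q (t - u))"
    by (auto intro!: continuous_on_compose2[OF cont] continuous_intros)
  then have "integral {0..pi} (\<lambda>u. q (t + u) + q (t - u))
      = integral {0..pi} (\<lambda>u. q (t + u)) + integral {0..pi} (\<lambda>u. q (t - u))"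
    by (intro integral_add integrable_continuous_interval)
  ultimately show ?thesis by linarith
qed

section \<open>Values in a Stolz region and averages over arcs\<close>

text \<open>The chord is \<open>2 sin (\<bar>u\<bar> / 2)\<close>, and on \<open>{0..pi / 2}\<close> the Taylor bound \<open>x - sin x \<le> x\<^sup>3 / 6\<close>
  gives \<open>sin x \<ge> x / 2\<close>.\<close>

lemma half_le_cis_minus_1:
  assumes "\<bar>u\<bar> \<le> pi"
  shows "\<bar>u\<bar> / 2 \<le> cmod (cis u - 1)"
proof -
  have half: "x / 2 \<le> sin x" if "0 \<le> x" "x \<le> pi / 2" for x :: real
  proof -
    have "\<bar>sin x - (\<Sum>m<3. sin_coeff m * x ^ m)\<bar> \<le> inverse (fact 3) * \<bar>x\<bar> ^ 3"
      by (rule Maclaurin_sin_bound)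
    also have "(\<Sum>m<3. sin_coeff m * x ^ m) = x"
      by (simp add: numeral_3_eq_3 sin_coeff_def)
    finally have "\<bar>sin x - x\<bar> \<le> x ^ 3 / 6"
      using that by (simp add: numeral_3_eq_3)
    then have "x - sin x \<le> x ^ 3 / 6" by linarith
    moreover have "x * x \<le> 3"
    proof -
      have "x \<le> 1.6" using that pi_approx by simp
      then have "x * x \<le> 1.6 * 1.6" using that by (intro mult_mono) auto
      then show ?thesis by simp
    qed
    then have "x * (x * x) \<le> x * 3" using that by (intro mult_left_mono) auto
    ultimately show ?thesis by (simp add: power3_eq_cube)
  qed
  have "(cmod (cis u - 1))\<^sup>2 = (2 * sin (\<bar>u\<bar> / 2))\<^sup>2"
  proof -
    have "(cmod (cis u - 1))\<^sup>2 = 2 - 2 * cos u"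
      using sin_cos_squared_add[of u] unfolding cmod_power2 by (simp add: power2_eq_square algebra_simps)
    also have "cos u = cos (2 * (\<bar>u\<bar> / 2))" by simp
    also have "2 - 2 * \<dots> = (2 * sin (\<bar>u\<bar> / 2))\<^sup>2"
      unfolding cos_double_sin by (simp add: power2_eq_square)
    finally show ?thesis .
  qed
  note sq = this
  have ge: "(\<bar>u\<bar> / 2) / 2 \<le> sin (\<bar>u\<bar> / 2)"
    using assms by (intro half) auto
  then have "0 \<le> 2 * sin (\<bar>u\<bar> / 2)" by linarith
  then have "cmod (cis u - 1) = 2 * sin (\<bar>u\<bar> / 2)"
    by (rule power2_eq_imp_eq[OF sq norm_ge_zero])
  then show ?thesis using ge by simp
qed

text \<open>A kernel that decreases with the distance from \<open>t\<close> is a mixture of indicators of windows centred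
  at \<open>t\<close>, so its integral against \<open>f\<close> is at most \<open>A\<close> times its mass once every window average of
  \<open>f\<close> is at most \<open>A\<close>. The proof is an integration by parts in disguise: with
  \<open>\<Phi> u\<close> the integral of \<open>f\<close> over the window of radius \<open>u\<close>, the function \<open>k u * (2 A u - \<Phi> u)\<close> is
  0 at 0 and nonnegative at \<open>pi\<close>, and the term of its derivative that contains \<open>k'\<close> is
  nonpositive. The kernel used here dominates the Poisson kernel, and its mass is at most
  \<open>2 * pi / c\<close> because it has an arctangent as antiderivative.\<close>

lemma integral_averaging:
  fixes f :: "real \<Rightarrow> real"
  assumes cont: "continuous_on UNIV f" and "h > 0" "c > 0" "A \<ge> 0"
    and avg: "\<And>\<rho>. 0 < \<rho> \<Longrightarrow> \<rho> \<le> pi \<Longrightarrow> integral {t - \<rho>..t + \<rho>} f \<le> 2 * A * \<rho>"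
  shows "integral {0..pi} (\<lambda>u. 4 * h / (h\<^sup>2 + c\<^sup>2 * u\<^sup>2) * (f (t + u) + f (t - u))) \<le> 4 * pi * A / c"
proof -
  let ?k = "\<lambda>u. 4 * h / (h\<^sup>2 + c\<^sup>2 * u\<^sup>2)" and ?\<phi> = "\<lambda>u. f (t + u) + f (t - u)"
  let ?\<Phi> = "\<lambda>u. integral {0..u} ?\<phi>"
  have pos: "h\<^sup>2 + c\<^sup>2 * u\<^sup>2 > 0" for u using \<open>h > 0\<close> by (simp add: add_pos_nonneg)
  have cont_plus: "continuous_on S (\<lambda>u. f (t + u))" and cont_minus: "continuous_on S (\<lambda>u. f (t - u))" for S
    by (auto intro!: continuous_on_compose2[OF cont] continuous_intros)
  have cont_\<phi>: "continuous_on S ?\<phi>" for S by (intro continuous_intros cont_plus cont_minus)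
  have cont_k: "continuous_on S ?k" for S
    using pos by (intro continuous_intros) (auto simp: less_imp_neq[symmetric])
  have \<Phi>_eq: "?\<Phi> u = integral {t - u..t + u} f" if "0 \<le> u" for u
  proof -
    have int: "f integrable_on {a..b}" for a b
      by (intro integrable_continuous_interval continuous_on_subset[OF cont]) simp
    have "integral {t - u..t} f + integral {t..t + u} f = integral {t - u..t + u} f"
      using that by (intro Henstock_Kurzweil_Integration.integral_combine int) auto
    moreover have "integral {t..t + u} f = integral {0..u} (\<lambda>u. f (t + u))"
      using integral_shift_Icc_real[of 0 u f t] by (simp add: o_def add.commute)
    moreover have "integral {t - u..t} f = integral {0..u} (\<lambda>u. f (t - u))"
      using integral_shift_Icc_real[of "- u" 0 f t]
        Henstock_Kurzweil_Integration.integral_reflect_real[where a=0 and b=u and f="\<lambda>u. f (t - u)"]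
      by (simp add: o_def add.commute)
    moreover have "?\<Phi> u = integral {0..u} (\<lambda>u. f (t + u)) + integral {0..u} (\<lambda>u. f (t - u))"
      by (intro Henstock_Kurzweil_Integration.integral_add integrable_continuous_interval cont_plus cont_minus)
    ultimately show ?thesis by linarith
  qed
  have \<Phi>_le: "?\<Phi> u \<le> 2 * A * u" if "0 \<le> u" "u \<le> pi" for u
    using avg[of u] \<Phi>_eq[of u] that by (cases "u = 0") auto
  let ?k' = "\<lambda>u. - (4 * h * (c\<^sup>2 * (2 * u))) / (h\<^sup>2 + c\<^sup>2 * u\<^sup>2)\<^sup>2"
  let ?E = "\<lambda>u. ?k u * (2 * A * u - ?\<Phi> u)"
  let ?E' = "\<lambda>u. ?k u * (2 * A - ?\<phi> u) + ?k' u * (2 * A * u - ?\<Phi> u)"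
  have "(?E' has_integral ?E pi - ?E 0) {0..pi}"
  proof (rule fundamental_theorem_of_calculus)
    fix u assume u: "u \<in> {0..pi}"
    have "(?k has_real_derivative ?k' u) (at u within {0..pi})"
      using pos[of u] by (auto intro!: derivative_eq_intros simp: power2_eq_square)
    moreover have "(?\<Phi> has_real_derivative ?\<phi> u) (at u within {0..pi})"
      by (rule integral_has_real_derivative[OF cont_\<phi> u])
    then have "((\<lambda>u. 2 * A * u - ?\<Phi> u) has_real_derivative 2 * A - ?\<phi> u) (at u within {0..pi})"
      by (auto intro!: derivative_eq_intros)
    ultimately have "(?E has_real_derivative ?E' u) (at u within {0..pi})"
      using DERIV_mult by (fastforce simp: algebra_simps)
    then show "(?E has_vector_derivative ?E' u) (at u within {0..pi})"
      by (simp add: has_real_derivative_iff_has_vector_derivative)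
  qed simp
  moreover have "((\<lambda>u. ?k u * (2 * A - ?\<phi> u)) has_integral
      integral {0..pi} (\<lambda>u. ?k u * (2 * A - ?\<phi> u))) {0..pi}"
    by (intro integrable_integral integrable_continuous_interval continuous_on_mult continuous_on_diff
        continuous_on_const cont_k cont_\<phi>)
  ultimately have "?E pi - ?E 0 \<le> integral {0..pi} (\<lambda>u. ?k u * (2 * A - ?\<phi> u))"
  proof (rule has_integral_le)
    fix u assume u: "u \<in> {0..pi}"
    have "?k' u \<le> 0" using u \<open>h > 0\<close> by (intro divide_nonpos_nonneg) auto
    then have "?k' u * (2 * A * u - ?\<Phi> u) \<le> 0"
      using \<Phi>_le u by (intro mult_nonpos_nonneg) auto
    then show "?E' u \<le> ?k u * (2 * A - ?\<phi> u)" by linarith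
  qed
  moreover have "?E pi \<ge> 0"
    using \<Phi>_le[of pi] pos[of pi] \<open>h > 0\<close> by (intro mult_nonneg_nonneg divide_nonneg_pos) auto
  moreover have "integral {0..pi} (\<lambda>u. ?k u * (2 * A - ?\<phi> u))
      = 2 * A * integral {0..pi} ?k - integral {0..pi} (\<lambda>u. ?k u * ?\<phi> u)"
  proof -
    have "k * (2 * A - p) = 2 * A * k - k * p" for k p by (simp add: algebra_simps)
    then have "integral {0..pi} (\<lambda>u. ?k u * (2 * A - ?\<phi> u))
        = integral {0..pi} (\<lambda>u. 2 * A * ?k u - ?k u * ?\<phi> u)"
      by (simp only:)
    also have "\<dots> = integral {0..pi} (\<lambda>u. 2 * A * ?k u) - integral {0..pi} (\<lambda>u. ?k u * ?\<phi> u)"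
      by (intro Henstock_Kurzweil_Integration.integral_diff integrable_continuous_interval continuous_on_mult
        continuous_on_const cont_k cont_\<phi>)
    also have "integral {0..pi} (\<lambda>u. 2 * A * ?k u) = 2 * A * integral {0..pi} ?k"
      by (rule Henstock_Kurzweil_Integration.integral_mult_right)
    finally show ?thesis .
  qed
  moreover have "integral {0..pi} ?k \<le> 2 * pi / c"
  proof -
    have "(?k has_integral (4 / c * arctan (c * pi / h) - 4 / c * arctan (c * 0 / h))) {0..pi}"
    proof (rule fundamental_theorem_of_calculus)
      fix u
      have "((\<lambda>u. 4 / c * arctan (c * u / h)) has_real_derivative
          4 / c * (inverse (1 + (c * u / h)\<^sup>2) * (c / h))) (at u within {0..pi})"
        using \<open>h > 0\<close> by (auto intro!: derivative_eq_intros)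
      also have "1 + (c * u / h)\<^sup>2 = (h\<^sup>2 + c\<^sup>2 * u\<^sup>2) / h\<^sup>2"
        using \<open>h > 0\<close> by (simp add: field_simps)
      also have "4 / c * (inverse ((h\<^sup>2 + c\<^sup>2 * u\<^sup>2) / h\<^sup>2) * (c / h)) = ?k u"
        using \<open>h > 0\<close> \<open>c > 0\<close> by (simp add: power2_eq_square)
      finally have "((\<lambda>u. 4 / c * arctan (c * u / h)) has_real_derivative ?k u) (at u within {0..pi})" .
      then show "((\<lambda>u. 4 / c * arctan (c * u / h)) has_vector_derivative ?k u) (at u within {0..pi})"
        by (simp add: has_real_derivative_iff_has_vector_derivative)
    qed simp
    then have "integral {0..pi} ?k = 4 / c * arctan (c * pi / h)"
      by (simp add: integral_unique)
    also have "\<dots> \<le> 4 / c * (pi / 2)"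
      using arctan_ubound[of "c * pi / h"] \<open>c > 0\<close> by (intro mult_left_mono) auto
    finally show ?thesis by simp
  qed
  then have "2 * A * integral {0..pi} ?k \<le> 2 * A * (2 * pi / c)"
    using \<open>A \<ge> 0\<close> by (intro mult_left_mono) auto
  ultimately show ?thesis by (simp add: algebra_simps)
qed

text \<open>In the Stolz region the distance \<open>\<bar>cis s - z\<bar>\<close> is at least \<open>h = 1 - \<bar>z\<bar>\<close> and at least a multiple
  \<open>c\<close> of \<open>\<bar>s - t\<bar>\<close>, where \<open>c\<close> depends on the aperture \<open>M\<close> only. Therefore the Poisson kernel of \<open>z\<close>
  is dominated by the kernel of the preceding lemma, centred at \<open>t\<close>.\<close>

lemma stolz_square_le:
  assumes cont: "continuous_on (cball 0 1) g" and holo: "g holomorphic_on ball 0 1"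
    and t: "0 \<le> t" "t \<le> 2 * pi" and z: "z \<in> stolz_region (cis t) M" and "A \<ge> 0"
    and avg: "\<And>\<rho>. 0 < \<rho> \<Longrightarrow> \<rho> \<le> pi \<Longrightarrow> integral {t - \<rho>..t + \<rho>} (\<lambda>s. (cmod (g (cis s)))\<^sup>2) \<le> 2 * A * \<rho>"
  shows "(cmod (g z))\<^sup>2 \<le> 4 * (1 + M) * A"
proof -
  define h where "h = 1 - cmod z"
  have "cmod z < 1" and near: "cmod (z - cis t) < M * h" using z by (auto simp: stolz_region_def h_def)
  then have "h > 0" by (auto simp: h_def)
  have "M * h > 0" using near by (meson le_less_trans norm_ge_zero)
  then have "M > 0" using \<open>h > 0\<close> by (simp add: zero_less_mult_iff)
  \<comment> \<open>The chord from \<open>cis t\<close> to \<open>cis s\<close> is at least half of the arc and at most \<open>1 + M\<close> times the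
    distance from \<open>z\<close> to \<open>cis s\<close>.\<close>
  define c where "c = 1 / (2 * (1 + M))"
  have "c > 0" using \<open>M > 0\<close> by (simp add: c_def)
  let ?f = "\<lambda>s. (cmod (g (cis s)))\<^sup>2"
  let ?P = "\<lambda>s. (1 - (cmod z)\<^sup>2) / (cmod (cis s - z))\<^sup>2"
  let ?k = "\<lambda>u. 4 * h / (h\<^sup>2 + c\<^sup>2 * u\<^sup>2)"
  have dist: "h \<le> cmod (cis s - z)" for s
    using norm_triangle_ineq2[of "cis s" z] by (simp add: h_def)
  have ne: "cis s - z \<noteq> 0" for s using dist[of s] \<open>h > 0\<close> by auto
  have cont_g: "continuous_on S (\<lambda>s. g (cis s))" for S
    by (rule continuous_on_compose2[OF cont]) (auto intro!: continuous_intros)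
  have cont_f: "continuous_on S ?f" for S by (intro continuous_intros cont_g)
  have cont_P: "continuous_on S ?P" for S using ne by (intro continuous_intros) auto
  have P_le: "?P (t + u) \<le> ?k u" if "\<bar>u\<bar> \<le> pi" for u
  proof -
    let ?d = "cmod (cis (t + u) - z)"
    have "cmod (cis (t + u) - cis t) = cmod (cis u - 1)"
    proof -
      have "cis (t + u) - cis t = cis t * (cis u - 1)" by (simp add: cis_mult[symmetric] algebra_simps)
      then show ?thesis by (simp add: norm_mult)
    qed
    moreover have "cmod (cis (t + u) - cis t) \<le> ?d + cmod (z - cis t)"
      using norm_triangle_ineq[of "cis (t + u) - z" "z - cis t"] by simp
    moreover have "M * h \<le> M * ?d" using dist \<open>M > 0\<close> by (intro mult_left_mono) auto
    ultimately have "\<bar>u\<bar> / 2 \<le> (1 + M) * ?d"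
      using near half_le_cis_minus_1[OF that] by (simp add: algebra_simps)
    then have "c * \<bar>u\<bar> \<le> ?d" using \<open>M > 0\<close> by (simp add: c_def field_simps)
    then have "(c * \<bar>u\<bar>)\<^sup>2 \<le> ?d\<^sup>2" using \<open>c > 0\<close> by (intro power_mono) auto
    moreover have "h\<^sup>2 \<le> ?d\<^sup>2" using dist \<open>h > 0\<close> by (intro power_mono) auto
    ultimately have d2: "(h\<^sup>2 + c\<^sup>2 * u\<^sup>2) / 2 \<le> ?d\<^sup>2" by (simp add: power_mult_distrib)
    have num: "1 - (cmod z)\<^sup>2 \<le> 2 * h"
      unfolding h_def using zero_le_power2[of "1 - cmod z"] by (simp add: power2_eq_square algebra_simps)
    have pos: "0 < h\<^sup>2 + c\<^sup>2 * u\<^sup>2" using \<open>h > 0\<close> by (simp add: add_pos_nonneg)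
    have "?P (t + u) \<le> 2 * h / ((h\<^sup>2 + c\<^sup>2 * u\<^sup>2) / 2)"
      using num d2 pos \<open>h > 0\<close> by (intro frac_le) auto
    then show ?thesis by simp
  qed
  have "2 * pi * (cmod (g z))\<^sup>2 \<le> integral {0..2 * pi} (\<lambda>s. ?f s * ?P s)"
    by (rule poisson_square_le[OF cont holo \<open>cmod z < 1\<close>])
  also have "\<dots> = integral {0..pi} (\<lambda>u. ?f (t + u) * ?P (t + u) + ?f (t - u) * ?P (t - u))"
  proof (rule integral_periodic[OF _ _ t])
    show "continuous_on UNIV (\<lambda>s. ?f s * ?P s)" by (intro continuous_on_mult cont_f cont_P)
    have "cis (s + 2 * pi) = cis s" for s by (simp add: cis_mult[symmetric])
    then show "?f (s + 2 * pi) * ?P (s + 2 * pi) = ?f s * ?P s" for s by simp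
  qed
  also have "\<dots> \<le> integral {0..pi} (\<lambda>u. ?k u * (?f (t + u) + ?f (t - u)))"
  proof (rule Henstock_Kurzweil_Integration.integral_le)
    have comp: "continuous_on {0..pi} (\<lambda>u. q (t + u))" "continuous_on {0..pi} (\<lambda>u. q (t - u))"
      if "continuous_on UNIV q" for q :: "real \<Rightarrow> real"
      by (auto intro!: continuous_on_compose2[OF that] continuous_intros)
    show "(\<lambda>u. ?f (t + u) * ?P (t + u) + ?f (t - u) * ?P (t - u)) integrable_on {0..pi}"
      by (intro integrable_continuous_interval continuous_on_add continuous_on_mult
          comp[OF cont_f] comp[OF cont_P])
    have "h\<^sup>2 + c\<^sup>2 * u\<^sup>2 \<noteq> 0" for u using \<open>h > 0\<close> by (simp add: add_pos_nonneg less_imp_neq[symmetric])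
    then show "(\<lambda>u. ?k u * (?f (t + u) + ?f (t - u))) integrable_on {0..pi}"
      by (intro integrable_continuous_interval continuous_on_add continuous_on_mult
          comp[OF cont_f]) (auto intro!: continuous_intros)
    fix u assume "u \<in> {0..pi}"
    then have "?P (t + u) \<le> ?k u" "?P (t - u) \<le> ?k u" using P_le[of u] P_le[of "- u"] by auto
    then have "?f (t + u) * ?P (t + u) + ?f (t - u) * ?P (t - u) \<le> ?f (t + u) * ?k u + ?f (t - u) * ?k u"
      by (intro add_mono mult_left_mono) auto
    then show "?f (t + u) * ?P (t + u) + ?f (t - u) * ?P (t - u) \<le> ?k u * (?f (t + u) + ?f (t - u))"
      by (simp only: distrib_left mult.commute[of "?k u"])
  qed
  also have "\<dots> \<le> 4 * pi * A / c"
    by (rule integral_averaging[OF cont_f \<open>h > 0\<close> \<open>c > 0\<close> \<open>A \<ge> 0\<close> avg])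
  also have "\<dots> = 2 * pi * (4 * (1 + M) * A)" using \<open>M > 0\<close> by (simp add: c_def field_simps)
  finally show ?thesis by simp
qed

section \<open>The Hardy-Littlewood maximal inequality\<close>

text \<open>Every point at which some window average exceeds \<open>A\<close> is the centre of an interval whose length is
  at most its integral of \<open>f\<close> divided by \<open>A\<close>. By Vitali's covering lemma disjoint intervals of
  this kind can be selected whose fivefold enlargements cover all such points; the integrals of
  \<open>f\<close> over disjoint intervals add up to at most its integral over two periods.\<close>

lemma maximal_inequality:
  fixes f :: "real \<Rightarrow> real"
  assumes cont: "continuous_on UNIV f" and nonneg: "\<And>s. 0 \<le> f s" and per: "\<And>s. f (s + 2 * pi) = f s"
    and "A > 0"
  obtains U where "U \<in> lmeasurable" "measure lebesgue U \<le> 10 * integral {0..2 * pi} f / A"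
    "\<And>t \<rho>. t \<in> {0..2 * pi} \<Longrightarrow> t \<notin> U \<Longrightarrow> 0 < \<rho> \<Longrightarrow> \<rho> \<le> pi \<Longrightarrow> integral {t - \<rho>..t + \<rho>} f \<le> 2 * A * \<rho>"
proof -
  define K where "K = {i :: real \<times> real. fst i \<in> {0..2 * pi} \<and> 0 < snd i \<and> snd i \<le> pi
      \<and> integral {fst i - snd i..fst i + snd i} f > 2 * A * snd i}"
  have K: "0 < snd i \<and> snd i \<le> pi" if "i \<in> K" for i using that by (simp add: K_def)
  have "\<exists>C. countable C \<and> C \<subseteq> K
    \<and> pairwise (\<lambda>i j. disjnt (cball (fst i) (snd i)) (cball (fst j) (snd j))) C
    \<and> (\<forall>i\<in>K. \<exists>j. j \<in> C \<and> \<not> disjnt (cball (fst i) (snd i)) (cball (fst j) (snd j))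
        \<and> cball (fst i) (snd i) \<subseteq> ball (fst j) (5 * snd j))"
  proof (rule Vitali_covering_lemma_cballs_balls[of K snd pi fst, OF K])
    fix C
    assume C: "countable C" "C \<subseteq> K"
      "pairwise (\<lambda>i j. disjnt (cball (fst i) (snd i)) (cball (fst j) (snd j))) C"
      and cover: "\<And>i. i \<in> K \<Longrightarrow> \<exists>j. j \<in> C \<and> \<not> disjnt (cball (fst i) (snd i)) (cball (fst j) (snd j))
        \<and> cball (fst i) (snd i) \<subseteq> ball (fst j) (5 * snd j)"
    show ?thesis by (rule exI[of _ C], intro conjI C ballI, rule cover)
  qed
  then obtain C where C: "countable C" "C \<subseteq> K"
    "pairwise (\<lambda>i j. disjnt (cball (fst i) (snd i)) (cball (fst j) (snd j))) C"
    and cover: "\<forall>i\<in>K. \<exists>j. j \<in> C \<and> \<not> disjnt (cball (fst i) (snd i)) (cball (fst j) (snd j))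
        \<and> cball (fst i) (snd i) \<subseteq> ball (fst j) (5 * snd j)"
    by (elim exE conjE)
  have int: "f integrable_on {a..b}" for a b
    by (intro integrable_continuous_interval continuous_on_subset[OF cont]) simp
  let ?I = "integral {0..2 * pi} f"
  have finite_bound: "measure lebesgue (\<Union>i\<in>J. ball (fst i) (5 * snd i)) \<le> 10 * ?I / A"
    if J: "J \<subseteq> C" "finite J" for J
  proof -
    have JK: "i \<in> K" if "i \<in> J" for i using J C(2) that by blast
    have "measure lebesgue (\<Union>i\<in>J. ball (fst i) (5 * snd i)) \<le> (\<Sum>i\<in>J. measure lebesgue (ball (fst i) (5 * snd i)))"
      by (intro measure_UNION_le J(2)) auto
    also have "\<dots> = (\<Sum>i\<in>J. 10 * snd i)"
    proof (rule sum.cong)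
      fix i assume "i \<in> J"
      then have "0 < snd i" using JK K by blast
      then show "measure lebesgue (ball (fst i) (5 * snd i)) = 10 * snd i"
        by (simp add: ball_eq_greaterThanLessThan)
    qed simp
    also have "\<dots> \<le> (\<Sum>i\<in>J. 5 / A * integral {fst i - snd i..fst i + snd i} f)"
    proof (rule sum_mono)
      fix i assume "i \<in> J"
      then have "2 * A * snd i < integral {fst i - snd i..fst i + snd i} f"
        using JK by (simp add: K_def)
      then show "10 * snd i \<le> 5 / A * integral {fst i - snd i..fst i + snd i} f"
        using \<open>A > 0\<close> by (simp add: field_simps)
    qed
    also have "\<dots> = 5 / A * (\<Sum>i\<in>J. integral {fst i - snd i..fst i + snd i} f)"
      by (simp add: sum_distrib_left)
    \<comment> \<open>Windows of radius at most \<open>pi\<close> about points of \<open>{0..2 * pi}\<close> stay within two periods.\<close>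
    also have "\<dots> \<le> 5 / A * integral {- pi..3 * pi} f"
    proof (rule mult_left_mono)
      have disj: "pairwise (\<lambda>i j. negligible ({fst i - snd i..fst i + snd i} \<inter> {fst j - snd j..fst j + snd j})) J"
        using pairwise_subset[OF C(3) J(1)]
        by (auto simp: pairwise_def disjnt_def cball_eq_atLeastAtMost)
      have UN: "(f has_integral (\<Sum>i\<in>J. integral {fst i - snd i..fst i + snd i} f))
          (\<Union>i\<in>J. {fst i - snd i..fst i + snd i})"
        by (intro has_integral_UN J(2) disj integrable_integral int)
      have "integral (\<Union>i\<in>J. {fst i - snd i..fst i + snd i}) f \<le> integral {- pi..3 * pi} f"
      proof (rule Henstock_Kurzweil_Integration.integral_subset_le)
        show "(\<Union>i\<in>J. {fst i - snd i..fst i + snd i}) \<subseteq> {- pi..3 * pi}"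
          using JK by (fastforce simp: K_def)
      qed (use UN int nonneg in auto)
      then show "(\<Sum>i\<in>J. integral {fst i - snd i..fst i + snd i} f) \<le> integral {- pi..3 * pi} f"
        using integral_unique[OF UN] by simp
    qed (use \<open>A > 0\<close> in simp)
    also have "integral {- pi..3 * pi} f = 2 * ?I"
    proof -
      have shift: "integral {a + 2 * pi..b + 2 * pi} f = integral {a..b} f" for a b
        using integral_shift_Icc_real[of a b f "2 * pi"] per by (simp add: o_def add.commute)
      have "integral {- pi..0} f + integral {0..3 * pi} f = integral {- pi..3 * pi} f"
        "integral {0..2 * pi} f + integral {2 * pi..3 * pi} f = integral {0..3 * pi} f"
        "integral {0..pi} f + integral {pi..2 * pi} f = integral {0..2 * pi} f"
        by (intro Henstock_Kurzweil_Integration.integral_combine int; simp)+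
      moreover have "integral {- pi..0} f = integral {pi..2 * pi} f"
        "integral {2 * pi..3 * pi} f = integral {0..pi} f"
        using shift[of "- pi" 0] shift[of 0 pi] by simp_all
      ultimately show ?thesis by linarith
    qed
    finally show ?thesis by simp
  qed
  show ?thesis
  proof
    show "(\<Union>i\<in>C. ball (fst i) (5 * snd i)) \<in> lmeasurable"
      using finite_bound by (intro fmeasurable_UN_bound[OF C(1)]) auto
    show "measure lebesgue (\<Union>i\<in>C. ball (fst i) (5 * snd i)) \<le> 10 * ?I / A"
      using finite_bound by (intro measure_UN_bound[OF C(1)]) auto
    fix t \<rho> assume t: "t \<in> {0..2 * pi}" "t \<notin> (\<Union>i\<in>C. ball (fst i) (5 * snd i))" and "0 < \<rho>" "\<rho> \<le> pi"
    show "integral {t - \<rho>..t + \<rho>} f \<le> 2 * A * \<rho>"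
    proof (rule ccontr)
      assume "\<not> ?thesis"
      then have "(t, \<rho>) \<in> K" using t(1) \<open>0 < \<rho>\<close> \<open>\<rho> \<le> pi\<close> by (simp add: K_def)
      then obtain j where "j \<in> C" "cball t \<rho> \<subseteq> ball (fst j) (5 * snd j)"
        using bspec[OF cover \<open>(t, \<rho>) \<in> K\<close>] by auto
      moreover have "t \<in> cball t \<rho>" using \<open>0 < \<rho>\<close> by simp
      ultimately show False using t(2) by blast
    qed
  qed
qed

text \<open>The sets \<open>\<Inter>k\<in>{K..}. U k\<close> increase with \<open>K\<close>, so any finite union of them lies in a single \<open>U k\<close>.\<close>

lemma liminf_measure_le:
  assumes meas: "\<And>k::nat. U k \<in> lmeasurable" and le: "\<And>k. measure lebesgue (U k) \<le> B"
  shows "(\<Union>K. \<Inter>k\<in>{K..}. U k) \<in> lmeasurable" "measure lebesgue (\<Union>K. \<Inter>k\<in>{K..}. U k) \<le> B"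
proof -
  let ?V = "\<lambda>K. \<Inter>k\<in>{K..}. U k"
  have V: "?V K \<in> lmeasurable" for K
  proof (rule fmeasurableI2[OF meas[of K]])
    show "?V K \<in> sets lebesgue"
      using meas by (intro sets.countable_INT') (auto intro: fmeasurableD)
  qed auto
  have fin: "measure lebesgue (\<Union>K\<in>J. ?V K) \<le> B" if "finite J" for J
  proof -
    have "(\<Union>K\<in>J. ?V K) \<subseteq> U (Max (insert 0 J))"
      using that by (fastforce intro: Max_ge)
    then have "measure lebesgue (\<Union>K\<in>J. ?V K) \<le> measure lebesgue (U (Max (insert 0 J)))"
      using V meas that by (intro measure_mono_fmeasurable) (auto intro: fmeasurableD)
    then show ?thesis using le order_trans by blast
  qed
  show "(\<Union>K. ?V K) \<in> lmeasurable" by (rule fmeasurable_UN_bound[of UNIV ?V]) (use V fin in auto)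
  show "measure lebesgue (\<Union>K. ?V K) \<le> B" by (rule measure_UN_bound[of UNIV ?V]) (use V fin in auto)
qed

section \<open>Nontangential limits\<close>

lemma continuous_on_l2_fun: "continuous_on unit_disc (l2_fun b)"
  by (rule holomorphic_on_imp_continuous_on[OF l2_fun_holomorphic])

lemma l2_fun_dilation:
  assumes "0 \<le> r" "r < 1"
  shows "continuous_on (cball 0 1) (\<lambda>w. l2_fun b (of_real r * w))"
    and "(\<lambda>w. l2_fun b (of_real r * w)) holomorphic_on ball 0 1"
proof -
  have in_disc: "of_real r * w \<in> unit_disc" if "cmod w \<le> 1" for w
  proof -
    have "r * cmod w \<le> r * 1" using that assms by (intro mult_left_mono) auto
    then show ?thesis using assms by (simp add: norm_mult)
  qed
  show "continuous_on (cball 0 1) (\<lambda>w. l2_fun b (of_real r * w))"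
    by (rule continuous_on_compose2[OF continuous_on_l2_fun]) (auto intro!: continuous_intros in_disc)
  have "(\<lambda>w. of_real r * w) holomorphic_on ball 0 1" by (intro holomorphic_intros)
  moreover have "(\<lambda>w. of_real r * w) ` ball 0 1 \<subseteq> unit_disc" using in_disc by force
  ultimately show "(\<lambda>w. l2_fun b (of_real r * w)) holomorphic_on ball 0 1"
    using holomorphic_on_compose_gen[of "\<lambda>w. of_real r * w" "ball 0 1" "l2_fun b" unit_disc]
      l2_fun_holomorphic by (simp add: o_def)
qed

text \<open>The weak type estimate for the nontangential maximal function. Since nothing is known yet about
  boundary values, the maximal inequality is applied to the dilates \<open>z \<mapsto> b (r z)\<close>, which are
  continuous up to the circle and have integral means bounded by the norm of \<open>b\<close>. A point where
  \<open>b\<close> is large somewhere in the Stolz region has this property for all dilates with \<open>r\<close> close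
  enough to 1, so it lies in the lower limit of the exceptional sets.\<close>

lemma nontangential_maximal_weak_type:
  assumes "M > 0" "y > 0"
  obtains U where "U \<in> lmeasurable" "measure lebesgue U \<le> 80 * pi * (1 + M) * (norm b)\<^sup>2 / y\<^sup>2"
    "{t \<in> {0..2 * pi}. \<exists>z\<in>stolz_region (cis t) M. y < cmod (l2_fun b z)} \<subseteq> U"
proof -
  define r where "r k = 1 - inverse (real (Suc k))" for k
  have r: "0 \<le> r k" "r k < 1" for k by (simp_all add: r_def inverse_le_1_iff)
  have r_lim: "r \<longlonglongrightarrow> 1"
    using tendsto_diff[OF tendsto_const[of 1] LIMSEQ_inverse_real_of_nat] by (simp add: r_def[abs_def])
  \<comment> \<open>The level for which the pointwise bound \<open>4 * (1 + M) * A\<close> in Stolz regions equals \<open>y\<^sup>2\<close>.\<close>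
  define A where "A = y\<^sup>2 / (4 * (1 + M))"
  have "A > 0" using assms by (simp add: A_def)
  let ?f = "\<lambda>k s. (cmod (l2_fun b (of_real (r k) * cis s)))\<^sup>2"
  let ?avg = "\<lambda>k t. \<forall>\<rho>. 0 < \<rho> \<longrightarrow> \<rho> \<le> pi \<longrightarrow> integral {t - \<rho>..t + \<rho>} (?f k) \<le> 2 * A * \<rho>"
  let ?B = "80 * pi * (1 + M) * (norm b)\<^sup>2 / y\<^sup>2"
  let ?good = "\<lambda>U k. U \<in> lmeasurable \<and> measure lebesgue U \<le> ?B \<and> (\<forall>t\<in>{0..2 * pi}. t \<notin> U \<longrightarrow> ?avg k t)"
  have "\<exists>U. ?good U k" for k
  proof -
    have "continuous_on UNIV (\<lambda>s. l2_fun b (of_real (r k) * cis s))"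
      by (rule continuous_on_compose2[OF l2_fun_dilation(1)[OF r]]) (auto intro!: continuous_intros)
    then have cont: "continuous_on UNIV (?f k)" by (intro continuous_intros)
    have per: "?f k (s + 2 * pi) = ?f k s" for s by (simp add: cis_mult[symmetric])
    obtain U where U: "U \<in> lmeasurable" "measure lebesgue U \<le> 10 * integral {0..2 * pi} (?f k) / A"
      "\<And>t \<rho>. t \<in> {0..2 * pi} \<Longrightarrow> t \<notin> U \<Longrightarrow> 0 < \<rho> \<Longrightarrow> \<rho> \<le> pi \<Longrightarrow> integral {t - \<rho>..t + \<rho>} (?f k) \<le> 2 * A * \<rho>"
      using maximal_inequality[of "?f k", OF cont zero_le_power2 per \<open>A > 0\<close>] by metis
    have "10 * integral {0..2 * pi} (?f k) / A \<le> 10 * (2 * pi * (norm b)\<^sup>2) / A"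
      using parseval_l2_fun_le[OF r, of b k] \<open>A > 0\<close> by (intro divide_right_mono mult_left_mono) auto
    also have "\<dots> = ?B" using assms by (simp add: A_def field_simps)
    finally have "measure lebesgue U \<le> ?B" using U(2) by linarith
    then show ?thesis using U(1,3) by (intro exI[of _ U]) simp
  qed
  then have "\<exists>U. \<forall>k. ?good (U k) k" by (intro choice allI)
  then obtain U where good: "\<forall>k. ?good (U k) k" ..
  then have U: "\<And>k. U k \<in> lmeasurable" "\<And>k. measure lebesgue (U k) \<le> ?B"
    by simp_all
  have "{t \<in> {0..2 * pi}. \<exists>z\<in>stolz_region (cis t) M. y < cmod (l2_fun b z)} \<subseteq> (\<Union>K. \<Inter>k\<in>{K..}. U k)"
  proof clarify
    fix t z assume t: "t \<in> {0..2 * pi}" and z: "z \<in> stolz_region (cis t) M" and gt: "y < cmod (l2_fun b z)"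
    have "z \<in> unit_disc" using z by (simp add: stolz_region_def)
    then have "isCont (l2_fun b) z"
      using continuous_on_l2_fun by (simp add: continuous_on_eq_continuous_at)
    moreover have "(\<lambda>k. of_real (r k) * z) \<longlonglongrightarrow> of_real 1 * z"
      by (intro tendsto_intros r_lim)
    ultimately have "(\<lambda>k. l2_fun b (of_real (r k) * z)) \<longlonglongrightarrow> l2_fun b z"
      by (intro isCont_tendsto_compose[of z "l2_fun b"]) auto
    then have "(\<lambda>k. cmod (l2_fun b (of_real (r k) * z))) \<longlonglongrightarrow> cmod (l2_fun b z)" by (rule tendsto_norm)
    then have "\<forall>\<^sub>F k in sequentially. y < cmod (l2_fun b (of_real (r k) * z))" using gt by (rule order_tendstoD(1))
    then obtain K where K: "\<And>k. k \<ge> K \<Longrightarrow> y < cmod (l2_fun b (of_real (r k) * z))"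
      unfolding eventually_sequentially by blast
    have "t \<in> U k" if "k \<ge> K" for k
    proof (rule ccontr)
      assume "t \<notin> U k"
      then have "?avg k t" using good t by blast
      then have avg: "integral {t - \<rho>..t + \<rho>} (?f k) \<le> 2 * A * \<rho>" if "0 < \<rho>" "\<rho> \<le> pi" for \<rho>
        using that by blast
      have "(cmod (l2_fun b (of_real (r k) * z)))\<^sup>2 \<le> 4 * (1 + M) * A"
        by (rule stolz_square_le[OF l2_fun_dilation[OF r] _ _ z _ avg]) (use t \<open>A > 0\<close> in auto)
      moreover have "4 * (1 + M) * A = y\<^sup>2" using assms by (simp add: A_def)
      ultimately have "(cmod (l2_fun b (of_real (r k) * z)))\<^sup>2 \<le> y\<^sup>2" by simp
      then have "cmod (l2_fun b (of_real (r k) * z)) \<le> y"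
        by (rule power2_le_imp_le) (use assms in simp)
      then show False using K[OF that] by simp
    qed
    then show "t \<in> (\<Union>K. \<Inter>k\<in>{K..}. U k)" by blast
  qed
  then show ?thesis
    using that[OF liminf_measure_le[of U, OF U(1,2)]] by simp
qed

lemma AE_lebesgue_onI:
  assumes "negligible N" "\<And>t. t \<in> S \<Longrightarrow> t \<notin> N \<Longrightarrow> P t" "S \<in> sets lebesgue"
  shows "AE t in lebesgue_on S. P t"
proof (subst AE_restrict_space_iff)
  show "AE t in lebesgue. t \<in> S \<longrightarrow> P t"
    by (rule AE_I'[of N]) (use assms in \<open>auto simp: negligible_iff_null_sets\<close>)
qed (use assms in auto)

lemma stolz_region_mono: "M \<le> M' \<Longrightarrow> stolz_region \<zeta> M \<subseteq> stolz_region \<zeta> M'"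
proof
  fix z assume "M \<le> M'" and z: "z \<in> stolz_region \<zeta> M"
  have "cmod (z - \<zeta>) < M * (1 - cmod z)" using z by (simp add: stolz_region_def)
  also have "\<dots> \<le> M' * (1 - cmod z)"
    using z \<open>M \<le> M'\<close> by (intro mult_right_mono) (auto simp: stolz_region_def)
  finally show "z \<in> stolz_region \<zeta> M'" using z by (simp add: stolz_region_def)
qed

text \<open>Uniform approximation on Stolz regions by functions continuous at the vertex is a Cauchy
  condition. The limit is read off along the radius, which is contained in the Stolz regions of
  all apertures \<open>M > 1\<close>; hence it does not depend on the aperture.\<close>

lemma nontangential_limitI_approx:
  assumes \<zeta>: "cmod \<zeta> = 1"
    and approx: "\<And>M e. M > 1 \<Longrightarrow> e > 0 \<Longrightarrow> \<exists>p. isCont p \<zeta> \<and> (\<forall>z\<in>stolz_region \<zeta> M. cmod (f z - p z) \<le> e)"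
  shows "\<exists>L. nontangential_limit f \<zeta> L"
proof -
  have cauchy: "\<exists>d>0. \<forall>z\<in>stolz_region \<zeta> M. \<forall>w\<in>stolz_region \<zeta> M.
      dist z \<zeta> < d \<longrightarrow> dist w \<zeta> < d \<longrightarrow> dist (f z) (f w) < e" if "M > 1" and "e > 0" for M e
  proof -
    have "e / 4 > 0" using \<open>e > 0\<close> by simp
    then obtain p where p: "isCont p \<zeta>" "\<And>z. z \<in> stolz_region \<zeta> M \<Longrightarrow> cmod (f z - p z) \<le> e / 4"
      using approx[OF \<open>M > 1\<close>] by blast
    obtain d where d: "d > 0" "\<And>z. dist z \<zeta> < d \<Longrightarrow> dist (p z) (p \<zeta>) < e / 4"
      using p(1) \<open>e > 0\<close> unfolding continuous_at_eps_delta by (metis zero_less_divide_iff zero_less_numeral)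
    have "dist (f z) (f w) < e" if "z \<in> stolz_region \<zeta> M" "w \<in> stolz_region \<zeta> M" "dist z \<zeta> < d" "dist w \<zeta> < d" for z w
    proof -
      have "dist (f z) (p z) \<le> e / 4" "dist (f w) (p w) \<le> e / 4" using p(2) that by (simp_all add: dist_norm)
      moreover have "dist (p z) (p \<zeta>) < e / 4" "dist (p w) (p \<zeta>) < e / 4" using d(2) that by auto
      moreover have "dist (f z) (f w) \<le> dist (f z) (p z) + dist (p z) (p \<zeta>) + (dist (f w) (p w) + dist (p w) (p \<zeta>))"
        using dist_triangle[of "f z" "f w" "p z"] dist_triangle[of "p z" "f w" "p \<zeta>"]
          dist_triangle[of "p \<zeta>" "f w" "p w"]
        by (simp add: dist_commute)
      ultimately show ?thesis by linarith
    qed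
    then show ?thesis using d(1) by blast
  qed
  define x where "x k = of_real (1 - inverse (real (Suc k))) * \<zeta>" for k
  have x_stolz: "x k \<in> stolz_region \<zeta> M" if "M > 1" for k M
  proof -
    have "cmod (x k) = 1 - inverse (real (Suc k))"
      unfolding x_def norm_mult norm_of_real \<zeta> by (simp add: inverse_le_1_iff)
    moreover have "x k - \<zeta> = - of_real (inverse (real (Suc k))) * \<zeta>" by (simp add: x_def algebra_simps)
    then have "cmod (x k - \<zeta>) = inverse (real (Suc k))"
      by (simp only: norm_mult norm_minus_cancel norm_of_real \<zeta>) simp
    moreover have "1 * inverse (real (Suc k)) < M * inverse (real (Suc k))"
      using that by (intro mult_strict_right_mono) auto
    ultimately show ?thesis by (simp add: stolz_region_def)
  qed
  have "x \<longlonglongrightarrow> of_real (1 - 0) * \<zeta>"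
    unfolding x_def[abs_def] by (intro tendsto_intros LIMSEQ_inverse_real_of_nat)
  then have x_lim: "x \<longlonglongrightarrow> \<zeta>" by simp
  have "Cauchy (\<lambda>k. f (x k))"
  proof (rule metric_CauchyI)
    fix e :: real assume "e > 0"
    obtain d where "d > 0" and d: "\<And>z w. z \<in> stolz_region \<zeta> 2 \<Longrightarrow> w \<in> stolz_region \<zeta> 2 \<Longrightarrow>
        dist z \<zeta> < d \<Longrightarrow> dist w \<zeta> < d \<Longrightarrow> dist (f z) (f w) < e"
      using cauchy[of 2 e] \<open>e > 0\<close> by auto
    obtain K where "\<And>k. k \<ge> K \<Longrightarrow> dist (x k) \<zeta> < d" using metric_LIMSEQ_D[OF x_lim \<open>d > 0\<close>] by blast
    then have "dist (f (x m)) (f (x k)) < e" if "m \<ge> K" "k \<ge> K" for m k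
      using that by (intro d x_stolz) auto
    then show "\<exists>K. \<forall>m\<ge>K. \<forall>k\<ge>K. dist (f (x m)) (f (x k)) < e" by blast
  qed
  then obtain L where L: "(\<lambda>k. f (x k)) \<longlonglongrightarrow> L" unfolding Cauchy_convergent_iff convergent_def by blast
  have "nontangential_limit f \<zeta> L"
    unfolding nontangential_limit_def Lim_within
  proof (intro allI impI)
    fix M e :: real assume "1 < M" "0 < e"
    obtain d where "d > 0" and d: "\<And>z w. z \<in> stolz_region \<zeta> M \<Longrightarrow> w \<in> stolz_region \<zeta> M \<Longrightarrow>
        dist z \<zeta> < d \<Longrightarrow> dist w \<zeta> < d \<Longrightarrow> dist (f z) (f w) < e / 2"
      using cauchy[of M "e / 2"] \<open>1 < M\<close> \<open>0 < e\<close> by auto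
    obtain K where K: "\<And>k. k \<ge> K \<Longrightarrow> dist (x k) \<zeta> < d" using metric_LIMSEQ_D[OF x_lim \<open>d > 0\<close>] by blast
    obtain K' where K': "\<And>k. k \<ge> K' \<Longrightarrow> dist (f (x k)) L < e / 2"
      using metric_LIMSEQ_D[OF L, of "e / 2"] \<open>0 < e\<close> by auto
    have "dist (f z) L < e" if "z \<in> stolz_region \<zeta> M" "dist z \<zeta> < d" for z
    proof -
      have "dist (f z) (f (x (max K K'))) < e / 2"
        using d[OF that(1) x_stolz[OF \<open>1 < M\<close>] that(2)] K by simp
      moreover have "dist (f (x (max K K'))) L < e / 2" using K' by simp
      ultimately show ?thesis using dist_triangle[of "f z" L "f (x (max K K'))"] by linarith
    qed
    then show "\<exists>d>0. \<forall>z\<in>stolz_region \<zeta> M. 0 < dist z \<zeta> \<and> dist z \<zeta> < d \<longrightarrow> dist (f z) L < e"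
      using \<open>d > 0\<close> by blast
  qed
  then show ?thesis by blast
qed

lemma nontangential_limit_radial:
  assumes "nontangential_limit f \<zeta> L" "cmod \<zeta> = 1" "r \<longlonglongrightarrow> 1" "\<And>k. 0 \<le> r k" "\<And>k. r k < (1 :: real)"
  shows "(\<lambda>k. f (of_real (r k) * \<zeta>)) \<longlonglongrightarrow> L"
proof -
  have "(f \<longlongrightarrow> L) (at \<zeta> within stolz_region \<zeta> 2)" using assms(1) by (simp add: nontangential_limit_def)
  moreover have "filterlim (\<lambda>k. of_real (r k) * \<zeta>) (at \<zeta> within stolz_region \<zeta> 2) sequentially"
    unfolding filterlim_at
  proof (intro conjI always_eventually allI)
    have "(\<lambda>k. of_real (r k) * \<zeta>) \<longlonglongrightarrow> of_real 1 * \<zeta>" by (intro tendsto_intros assms(3))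
    then show "(\<lambda>k. of_real (r k) * \<zeta>) \<longlonglongrightarrow> \<zeta>" by simp
    fix k
    have norm: "cmod (of_real (r k) * \<zeta>) = r k" using assms by (simp add: norm_mult)
    have "of_real (r k) * \<zeta> - \<zeta> = of_real (r k - 1) * \<zeta>" by (simp add: algebra_simps)
    then have "cmod (of_real (r k) * \<zeta> - \<zeta>) = 1 - r k"
      using assms(2) assms(5)[of k] by (simp only: norm_mult norm_of_real) simp
    then show "of_real (r k) * \<zeta> \<in> stolz_region \<zeta> 2" "of_real (r k) * \<zeta> \<noteq> \<zeta>"
      using norm assms(5)[of k] by (auto simp: stolz_region_def)
  qed
  ultimately show ?thesis by (rule filterlim_compose)
qed

text \<open>Fatou's theorem for the Hardy space. The Taylor polynomials are continuous everywhere, and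
  the remainders have norm tending to 0. By the weak type estimate the set of \<open>t\<close> for which all
  remainders exceed \<open>e\<close> somewhere in the Stolz region is contained in sets of arbitrarily small
  measure. Outside the union of these null sets over countably many \<open>M\<close> and \<open>e\<close>, the Taylor
  polynomials are approximations as needed for the existence of the limit.\<close>

theorem AE_nontangential_limit:
  "AE t in lebesgue_on {0..2 * pi}. \<exists>L. nontangential_limit (l2_fun a) (cis t) L"
proof -
  define b where "b N = a - (\<Sum>n<N. l2_nth a n *\<^sub>C (shift ^^ n) (kernel 0))" for N
  have b_nth: "l2_nth (b N) n = (if n < N then 0 else l2_nth a n)" for N n
    by (simp add: b_def l2_nth_monomial if_distrib[of "(*) _"] cong: if_cong)
  let ?p = "\<lambda>N z. \<Sum>n<N. l2_nth a n * z ^ n"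
  have l2_fun_b: "l2_fun (b N) z = l2_fun a z - ?p N z" if "cmod z < 1" for N z
  proof -
    have "(\<lambda>n. l2_nth a n * z ^ n - (if n \<in> {..<N} then l2_nth a n * z ^ n else 0)) sums (l2_fun a z - ?p N z)"
      by (intro sums_diff l2_fun_sums that sums_If_finite_set) simp
    also have "(\<lambda>n. l2_nth a n * z ^ n - (if n \<in> {..<N} then l2_nth a n * z ^ n else 0)) = (\<lambda>n. l2_nth (b N) n * z ^ n)"
      by (auto simp: b_nth)
    finally show ?thesis using l2_fun_sums[OF that, of "b N"] sums_unique2 by blast
  qed
  have b_lim: "(\<lambda>N. (norm (b N))\<^sup>2) \<longlonglongrightarrow> 0"
  proof -
    have eq: "(norm (b N))\<^sup>2 = (\<Sum>n. (cmod (l2_nth a (n + N)))\<^sup>2)" for N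
      unfolding norm_l2_square
      by (subst suminf_split_initial_segment[OF summable_l2_nth, of _ N]) (simp add: b_nth)
    show ?thesis unfolding eq by (rule suminf_exist_split2[OF summable_l2_nth])
  qed
  define Bad where "Bad M e = {t \<in> {0..2 * pi}. \<forall>N. \<exists>z\<in>stolz_region (cis t) M. e < cmod (l2_fun (b N) z)}" for M e
  have "negligible (Bad M e)" if Me: "M > 0" "e > 0" for M e
    unfolding negligible_outer_le
  proof (intro allI impI)
    fix \<delta> :: real assume "\<delta> > 0"
    have "(\<lambda>N. 80 * pi * (1 + M) * (norm (b N))\<^sup>2 / e\<^sup>2) \<longlonglongrightarrow> 80 * pi * (1 + M) * 0 / e\<^sup>2"
      by (intro tendsto_intros b_lim) (use that in auto)
    then have "\<forall>\<^sub>F N in sequentially. 80 * pi * (1 + M) * (norm (b N))\<^sup>2 / e\<^sup>2 < \<delta>"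
      by (rule order_tendstoD(2)) (use \<open>\<delta> > 0\<close> in simp)
    then obtain N where N: "80 * pi * (1 + M) * (norm (b N))\<^sup>2 / e\<^sup>2 < \<delta>"
      unfolding eventually_sequentially by blast
    obtain U where U: "U \<in> lmeasurable" "measure lebesgue U \<le> 80 * pi * (1 + M) * (norm (b N))\<^sup>2 / e\<^sup>2"
      "{t \<in> {0..2 * pi}. \<exists>z\<in>stolz_region (cis t) M. e < cmod (l2_fun (b N) z)} \<subseteq> U"
      by (rule nontangential_maximal_weak_type[OF Me])
    then have "Bad M e \<subseteq> U" by (auto simp: Bad_def)
    then show "\<exists>T. Bad M e \<subseteq> T \<and> T \<in> lmeasurable \<and> measure lebesgue T \<le> \<delta>"
      using U N by (intro exI[of _ U]) auto
  qed
  then have "negligible (\<Union>m. \<Union>k. Bad (real (Suc m)) (inverse (real (Suc k))))"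
    by (intro negligible_Union_nat[rule_format] allI) auto
  then show ?thesis
  proof (rule AE_lebesgue_onI)
    fix t assume t: "t \<in> {0..2 * pi}" "t \<notin> (\<Union>m. \<Union>k. Bad (real (Suc m)) (inverse (real (Suc k))))"
    show "\<exists>L. nontangential_limit (l2_fun a) (cis t) L"
    proof (rule nontangential_limitI_approx)
      fix M e :: real assume "M > 1" "e > 0"
      obtain m where m: "M \<le> real (Suc m)"
        by (meson le_Suc_eq nat_le_real_less of_nat_le_iff order_trans real_arch_simple)
      obtain k where k: "inverse (real (Suc k)) < e" using reals_Archimedean[OF \<open>e > 0\<close>] by blast
      have "t \<notin> Bad (real (Suc m)) (inverse (real (Suc k)))" using t(2) by blast
      then obtain N where N: "\<And>z. z \<in> stolz_region (cis t) (real (Suc m)) \<Longrightarrow> cmod (l2_fun (b N) z) \<le> inverse (real (Suc k))"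
        using t(1) unfolding Bad_def by (auto simp: not_less)
      show "\<exists>p. isCont p (cis t) \<and> (\<forall>z\<in>stolz_region (cis t) M. cmod (l2_fun a z - p z) \<le> e)"
      proof (intro exI[of _ "?p N"] conjI ballI)
        show "isCont (?p N) (cis t)" by (intro continuous_intros)
        fix z assume z: "z \<in> stolz_region (cis t) M"
        then have "cmod z < 1" by (simp add: stolz_region_def)
        moreover have "cmod (l2_fun (b N) z) \<le> inverse (real (Suc k))" using N stolz_region_mono[OF m] z by blast
        ultimately show "cmod (l2_fun a z - ?p N z) \<le> e" using k by (simp add: l2_fun_b)
      qed
    qed simp
  qed simp
qed

text \<open>The nonnegative functions \<open>1 - \<bar>a (r cis t)\<bar>\<^sup>2\<close> have integral tending to 0 as \<open>r\<close> tends to 1, by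
  Parseval's identity and \<open>norm a = 1\<close>. Along a sequence of radii they therefore tend to 0 almost
  everywhere, which identifies the modulus of the limit provided by Fatou's theorem.\<close>

theorem AE_unimodular_nontangential_limit:
  assumes le: "\<And>z. cmod (l2_fun a z) \<le> 1" and "norm a = 1"
  shows "AE t in lebesgue_on {0..2 * pi}. \<exists>L. nontangential_limit (l2_fun a) (cis t) L \<and> cmod L = 1"
proof -
  define r where "r k = 1 - inverse (real (Suc k))" for k
  have r: "0 \<le> r k" "r k < 1" for k by (simp_all add: r_def inverse_le_1_iff)
  have r_lim: "r \<longlonglongrightarrow> 1"
    using tendsto_diff[OF tendsto_const[of 1] LIMSEQ_inverse_real_of_nat] by (simp add: r_def[abs_def])
  define u where "u k t = 1 - (cmod (l2_fun a (of_real (r k) * cis t)))\<^sup>2" for k t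
  have u_nonneg: "0 \<le> u k t" for k t using le by (simp add: u_def abs_square_le_1)
  have "continuous_on {0..2 * pi} (\<lambda>s. l2_fun a (of_real (r k) * cis s))" for k
    by (rule continuous_on_compose2[OF l2_fun_dilation(1)[OF r]]) (auto intro!: continuous_intros)
  then have "continuous_on {0..2 * pi} (u k)" for k unfolding u_def by (intro continuous_intros)
  then have int: "integrable (lebesgue_on {0..2 * pi}) (u k)" for k
    by (rule continuous_imp_integrable_real)
  have "(\<lambda>k. \<integral>t. norm (u k t) \<partial>lebesgue_on {0..2 * pi}) \<longlonglongrightarrow> 0"
  proof -
    let ?S = "\<lambda>k. \<Sum>n. (cmod (l2_nth a n))\<^sup>2 * ((r k)\<^sup>2) ^ n"
    have "(\<integral>t. norm (u k t) \<partial>lebesgue_on {0..2 * pi}) = 2 * pi - 2 * pi * ?S k" for k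
    proof -
      have "(u k has_integral (2 * pi - 2 * pi * ?S k)) {0..2 * pi}"
        unfolding u_def using has_integral_diff[OF has_integral_const_real[of 1 0 "2 * pi"] parseval_l2_fun[OF r, of a k]]
        by simp
      then have "integral {0..2 * pi} (u k) = 2 * pi - 2 * pi * ?S k" by (rule integral_unique)
      then show ?thesis
        using u_nonneg lebesgue_integral_eq_integral[OF int] by simp
    qed
    moreover have "?S \<longlonglongrightarrow> (\<Sum>n. (cmod (l2_nth a n))\<^sup>2 * (1\<^sup>2) ^ n)"
    proof -
      have "((r k)\<^sup>2) ^ n \<le> 1" for k n using r by (intro power_le_one) (auto simp: abs_square_le_1 less_imp_le)
      then have "norm ((cmod (l2_nth a n))\<^sup>2 * ((r k)\<^sup>2) ^ n) \<le> (cmod (l2_nth a n))\<^sup>2" for k n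
        by (simp add: mult_left_le)
      then have "eventually (\<lambda>(n, k). norm ((cmod (l2_nth a n))\<^sup>2 * ((r k)\<^sup>2) ^ n) \<le> (cmod (l2_nth a n))\<^sup>2)
          (at_top \<times>\<^sub>F sequentially)"
        by (intro always_eventually) auto
      moreover have "(\<lambda>k. (cmod (l2_nth a n))\<^sup>2 * ((r k)\<^sup>2) ^ n) \<longlonglongrightarrow> (cmod (l2_nth a n))\<^sup>2 * (1\<^sup>2) ^ n" for n
        by (intro tendsto_intros r_lim)
      ultimately show ?thesis
        by (intro tannerys_theorem[OF _ _ summable_l2_nth[of a] sequentially_bot, THEN conjunct2, THEN conjunct2])
    qed
    then have "?S \<longlonglongrightarrow> 1" using norm_l2_square[of a] \<open>norm a = 1\<close> by simp
    then have "(\<lambda>k. 2 * pi - 2 * pi * ?S k) \<longlonglongrightarrow> 2 * pi - 2 * pi * 1" by (intro tendsto_intros)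
    ultimately show ?thesis by simp
  qed
  then obtain q where q: "strict_mono q" "AE t in lebesgue_on {0..2 * pi}. (\<lambda>k. u (q k) t) \<longlonglongrightarrow> 0"
    using tendsto_L1_AE_subseq[of "lebesgue_on {0..2 * pi}" u, OF int] by blast
  show ?thesis using q(2) AE_nontangential_limit[of a]
  proof eventually_elim
    case (elim t)
    then obtain L where L: "nontangential_limit (l2_fun a) (cis t) L" by blast
    have "(\<lambda>k. l2_fun a (of_real (r k) * cis t)) \<longlonglongrightarrow> L"
      by (rule nontangential_limit_radial[OF L _ r_lim r]) simp
    then have "(\<lambda>k. u k t) \<longlonglongrightarrow> 1 - (cmod L)\<^sup>2" unfolding u_def by (intro tendsto_intros)
    then have "(\<lambda>k. u (q k) t) \<longlonglongrightarrow> 1 - (cmod L)\<^sup>2"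
      using LIMSEQ_subseq_LIMSEQ[OF _ q(1)] by (fastforce simp: o_def)
    then have "1 - (cmod L)\<^sup>2 = 0" using elim(1) LIMSEQ_unique by blast
    then have "cmod L = 1" by (simp add: power2_eq_1_iff) (metis norm_ge_zero not_one_le_zero neg_0_le_iff_le)
    then show ?case using L by blast
  qed
qed

section \<open>Beurling's theorem on the Hardy space and its consequence\<close>

lemma l2_fun_in_H2: "l2_fun a \<in> H2"
  using l2_fun_holomorphic l2_fun_outside summable_l2_nth[of a]
  by (auto simp: H2_def taylor_coeff_l2_fun)

lemma H2_eq_range_l2_fun: "H2 = range l2_fun"
proof
  show "H2 \<subseteq> range l2_fun"
  proof
    fix f assume f: "f \<in> H2"
    then have nth: "l2_nth (Abs_l2 (taylor_coeff f)) = taylor_coeff f"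
      by (intro Abs_l2_inverse) (simp add: H2_def)
    have "f z = l2_fun (Abs_l2 (taylor_coeff f)) z" for z
    proof (cases "cmod z < 1")
      case True
      have "(\<lambda>n. taylor_coeff f n * z ^ n) sums f z"
        using f True by (intro sums_taylor_coeff) (auto simp: H2_def)
      then show ?thesis using l2_fun_sums[OF True, of "Abs_l2 (taylor_coeff f)"] sums_unique2
        unfolding nth by blast
    qed (use f in \<open>simp add: H2_def l2_fun_outside\<close>)
    then show "f \<in> range l2_fun" by blast
  qed
qed (use l2_fun_in_H2 in auto)

text \<open>This turns closedness in the metric space \<open>H2\<close> into closedness in \<open>l2\<close>.\<close>

lemma H2_dist_l2_fun: "H2_dist (l2_fun a) (l2_fun b) = dist a b"
  by (simp add: H2_dist_def H2_norm_def l2_fun_in_H2 taylor_coeff_diff l2_fun_holomorphic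
      taylor_coeff_l2_fun dist_norm norm_l2_eq)

lemma closed_vimage_l2_fun:
  assumes "closedin (Metric_space.mtopology H2 H2_dist) Y"
  shows "closed (l2_fun -` Y)"
  unfolding closed_sequential_limits
proof (intro allI impI, elim conjE)
  fix x l assume x: "\<forall>n. x n \<in> l2_fun -` Y" and lim: "x \<longlonglongrightarrow> l"
  interpret Metric_space H2 H2_dist by (rule Metric_space_H2)
  have "limitin mtopology (\<lambda>n. l2_fun (x n)) (l2_fun l) sequentially"
    unfolding limit_metric_sequentially using lim
    by (auto simp: l2_fun_in_H2 H2_dist_l2_fun lim_sequentially)
  moreover have "l \<in> Y" if "range \<sigma> \<subseteq> Y" "limitin mtopology \<sigma> l sequentially" for \<sigma> l
    using assms that unfolding metric_closedin_iff_sequentially_closed by metis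
  moreover have "range (\<lambda>n. l2_fun (x n)) \<subseteq> Y" using x by auto
  ultimately have "l2_fun l \<in> Y" by simp
  then show "l \<in> l2_fun -` Y" by simp
qed

lemma l2_fun_zero: "l2_fun 0 = (\<lambda>z. 0)"
  by (simp add: l2_fun_def fun_eq_iff)

lemma l2_fun_add: "l2_fun (a + b) = (\<lambda>z. l2_fun a z + l2_fun b z)"
  by (simp add: l2_fun_def cinner_add_left fun_eq_iff)

theorem beurling_H2:
  assumes Y: "closed_subspace_H2 Y" "Y \<noteq> {\<lambda>z. 0}" and z_invariant: "\<And>f. f \<in> Y \<Longrightarrow> (\<lambda>z. z * f z) \<in> Y"
  shows "\<exists>\<theta>. inner_function \<theta> \<and> Y = {mult_op \<theta> g | g. g \<in> H2}"
proof -
  interpret Metric_space H2 H2_dist by (rule Metric_space_H2)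
  have closedin: "closedin mtopology Y" and zero: "(\<lambda>z. 0) \<in> Y"
    and add: "\<And>f g. f \<in> Y \<Longrightarrow> g \<in> Y \<Longrightarrow> (\<lambda>z. f z + g z) \<in> Y"
    and scale: "\<And>c f. f \<in> Y \<Longrightarrow> (\<lambda>z. c * f z) \<in> Y"
    using Y(1) by (auto simp: closed_subspace_H2_def)
  have "Y \<subseteq> H2" using closedin_subset[OF closedin] by simp
  then have "Y \<subseteq> range l2_fun" by (simp only: H2_eq_range_l2_fun)
  then have Y_eq: "Y = l2_fun ` (l2_fun -` Y)" by blast
  have "l2_fun -` Y \<noteq> {0}"
  proof
    assume "l2_fun -` Y = {0}"
    then have "Y = {\<lambda>z. 0}" by (subst Y_eq) (simp add: l2_fun_zero)
    then show False using Y(2) by simp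
  qed
  have fun_scale: "l2_fun (c *\<^sub>C a) = (\<lambda>z. c * l2_fun a z)" for c a by (simp add: fun_eq_iff)
  have fun_shift: "l2_fun (shift a) = (\<lambda>z. z * l2_fun a z)" for a by (simp add: fun_eq_iff)
  obtain \<theta> where \<theta>: "wandering \<theta>" "l2_fun -` Y = range (l2_mult \<theta>)"
  proof (rule beurling_l2[of "l2_fun -` Y"])
    show "closed (l2_fun -` Y)" by (rule closed_vimage_l2_fun[OF closedin])
    show "l2_fun -` Y \<noteq> {0}" by fact
  qed (simp_all add: l2_fun_zero zero l2_fun_add add fun_scale scale fun_shift z_invariant)
  have "inner_function (l2_fun \<theta>)"
    unfolding inner_function_def
  proof
    show "l2_fun \<theta> \<in> Hinf"
      using l2_fun_holomorphic l2_fun_wandering_le_1[OF \<theta>(1)]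
      by (auto simp: Hinf_def intro!: boundedI)
    show "AE t in lebesgue_on {0..2 * pi}. \<exists>L. nontangential_limit (l2_fun \<theta>) (cis t) L \<and> cmod L = 1"
      using \<theta>(1) by (intro AE_unimodular_nontangential_limit l2_fun_wandering_le_1) (simp_all add: wandering_def)
  qed
  moreover have mult: "l2_fun (l2_mult \<theta> g) = mult_op (l2_fun \<theta>) (l2_fun g)" for g
    by (simp add: mult_op_def l2_fun_mult[OF \<theta>(1)] fun_eq_iff)
  have "Y = range (\<lambda>g. mult_op (l2_fun \<theta>) (l2_fun g))"
    by (subst Y_eq) (simp add: \<theta>(2) image_image mult)
  then have "Y = {mult_op (l2_fun \<theta>) g | g. g \<in> H2}"
    unfolding H2_eq_range_l2_fun by auto
  ultimately show ?thesis by blast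
qed

theorem theorem1p3:
  fixes \<phi> :: "complex \<Rightarrow> complex" and Y :: "(complex \<Rightarrow> complex) set"
  assumes "\<phi> \<in> Hinf" and "Hinf_norm \<phi> \<le> 1"
    and "\<phi> ` unit_disc \<subseteq> unit_disc"
    and "closed_subspace_H2 Y" and "Y \<noteq> {\<lambda>z. 0}"
    and "mult_op \<phi> ` Y \<subseteq> Y"
    and "\<And>f. f \<in> H2 \<Longrightarrow> f \<in> Y \<longleftrightarrow> disc_comp f \<phi> \<in> Y"
  shows "\<exists>\<theta>. inner_function \<theta> \<and> Y = {mult_op \<theta> g | g. g \<in> H2}"
proof (rule beurling_H2[OF assms(4,5)])
  fix f assume "f \<in> Y"
  interpret Metric_space H2 H2_dist by (rule Metric_space_H2)
  have "Y \<subseteq> H2"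
    using closedin_subset assms(4) unfolding closed_subspace_H2_def by fastforce
  then obtain a where a: "f = l2_fun a" using \<open>f \<in> Y\<close> H2_eq_range_l2_fun by blast
  have "(\<lambda>z. z * f z) = l2_fun (shift a)" by (simp add: a fun_eq_iff)
  then have zf: "(\<lambda>z. z * f z) \<in> H2" by (simp add: l2_fun_in_H2)
  have "disc_comp f \<phi> \<in> Y" using \<open>f \<in> Y\<close> \<open>Y \<subseteq> H2\<close> assms(7) by blast
  then have "mult_op \<phi> (disc_comp f \<phi>) \<in> Y" using assms(6) by blast
  also have "mult_op \<phi> (disc_comp f \<phi>) = disc_comp (\<lambda>z. z * f z) \<phi>"
    by (auto simp: mult_op_def disc_comp_def)
  finally show "(\<lambda>z. z * f z) \<in> Y" using assms(7)[OF zf] by blast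
qed

end
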